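(* Let $k,l\in\mathbb{N}$, $k\ge 1$, $l\ge 2$, and let $S$ be the Kac-Peterson matrix of type $A_1^{(1)}$ and level $k+l-1$. Then the Kac-Peterson matrix of type $C_l^{(1)}$ and level $k$ is the exterior power $\Lambda^l S$ of $S$: under a suitable bijection between the index set $P_+^k$ of type $C_l^{(1)}$ and the set of $l$-element subsets of the index set $P_+^{k+l-1}$ of type $A_1^{(1)}$ (the same bijection being used for rows and columns), the two matrices agree up to a non-zero constant scalar factor.
   Context: **Kac-Peterson matrices.** Let $\mathfrak g$ be the untwisted affine Kac-Moody algebra of type $X_l^{(1)}$, with fundamental weights $\Lambda_0,\dots,\Lambda_l$, dual Kac labels $a_0^\vee,\dots,a_l^\vee$ and dual Coxeter number $h^\vee=\sum_{i=0}^l a_i^\vee$. For a positive integer $k$ (the level) let $$P_+^k=\Big\{\sum_{j=0}^l\lambda_j\Lambda_j\ \Big|\ \lambda_j\in\mathbb{Z},\ \lambda_j\ge 0,\ \sum_{j=0}^l a_j^\vee\lambda_j=k\Big\}.$$ Let $\mathfrak g^\circ$ be the underlying finite dimensional simple Lie algebra of type $X_l$, with Weyl group $W^\circ$ and fundamental weights $\overline\Lambda_1,\dots,\overline\Lambda_l$; put $\overline\Lambda=\sum_{j=1}^l\lambda_j\overline\Lambda_j$ for $\Lambda=\sum_{j=0}^l\lambda_j\Lambda_j$, $\bar\rho=\sum_{j=1}^l\overline\Lambda_j$, and let $(\cdot\mid\cdot)$ be the normalized invariant form (long roots of $\mathfrak g^\circ$ have square length $2$). The Kac-Peterson matrix of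 type $X_l^{(1)}$ and level $k$ is the matrix indexed by $P_+^k$ with $$S_{\Lambda,\Lambda'}=c\sum_{w\in W^\circ}\det(w)\exp\left(-\frac{2\pi \mathrm{i}\,(\overline\Lambda+\bar\rho\mid w(\overline\Lambda'+\bar\rho))}{k+h^\vee}\right),$$ where $c$ is a non-zero constant independent of $\Lambda,\Lambda'$ whose value is regarded as unimportant. For $A_1^{(1)}$: $a_0^\vee=a_1^\vee=1$, $h^\vee=2$. For $C_l^{(1)}$: all $a_i^\vee=1$, $h^\vee=l+1$. **Exterior power.** For a square matrix $S$ indexed by a finite totally ordered set $I$, $\Lambda^l S$ is the matrix indexed by the $l$-element subsets $\{i_1<\dots<i_l\}$ of $I$, with entries $$(\Lambda^l S)_{\{i_1<\dots<i_l\},\{j_1<\dots<j_l\}}=\det\big((S_{i_\nu,j_{\nu'}})_{1\le\nu,\nu'\le l}\big).$$ For type $A_1^{(1)}$ the index set is ordered by the coefficient $\lambda_1$ of $\Lambda_1$. *)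

theory Defs
  imports "Jordan_Normal_Form.Determinant"
begin

text \<open>
  An affine Lie algebra of type \<open>X_l^(1)\<close> is given by its generalized Cartan matrix
  \<open>A i j = \<langle>\<alpha>_i^\<or>, \<alpha>_j\<rangle>\<close> (Kac's convention), relevant for \<open>i, j \<in> {0..l}\<close>; the nodes
  \<open>{1..l}\<close> belong to the underlying finite dimensional simple Lie algebra.
\<close>

definition cartan_A1_affine :: "nat \<Rightarrow> nat \<Rightarrow> int" where
  "cartan_A1_affine i j = (if i = j then 2 else - 2)"

text \<open>Here \<open>l \<ge> 2\<close>; the simple roots \<open>\<alpha>_0\<close> and \<open>\<alpha>_l\<close> are long, the others are short.\<close>

definition cartan_C_affine :: "nat \<Rightarrow> nat \<Rightarrow> nat \<Rightarrow> int" where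
  "cartan_C_affine l i j =
     (if i = j then 2
      else if (i = 1 \<and> j = 0) \<or> (i = l - 1 \<and> j = l) then - 2
      else if i = Suc j \<or> j = Suc i then - 1
      else 0)"

text \<open>
  The dual Kac labels are the coprime positive integers forming a left null vector of \<open>A\<close>.
\<close>

definition dual_kac_labels :: "(nat \<Rightarrow> nat \<Rightarrow> int) \<Rightarrow> nat \<Rightarrow> nat \<Rightarrow> nat" where
  "dual_kac_labels A l =
     (THE a. (\<forall>i\<le>l. 0 < a i) \<and> (\<forall>i>l. a i = 0) \<and>
             (\<forall>j\<le>l. (\<Sum>i\<le>l. int (a i) * A i j) = 0) \<and> Gcd (a ` {..l}) = 1)"

definition dual_coxeter_number :: "(nat \<Rightarrow> nat \<Rightarrow> int) \<Rightarrow> nat \<Rightarrow> nat" where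
  "dual_coxeter_number A l = (\<Sum>i\<le>l. dual_kac_labels A l i)"

text \<open>The weight \<open>\<Sum>j\<le>l. \<lambda>_j \<Lambda>_j\<close> is the function \<open>j \<mapsto> \<lambda>_j\<close>, extended by \<open>0\<close> beyond \<open>l\<close>.\<close>

definition dominant_weights :: "(nat \<Rightarrow> nat \<Rightarrow> int) \<Rightarrow> nat \<Rightarrow> nat \<Rightarrow> (nat \<Rightarrow> nat) set" where
  "dominant_weights A l k =
     {\<Lambda>. (\<forall>j>l. \<Lambda> j = 0) \<and> (\<Sum>j\<le>l. dual_kac_labels A l j * \<Lambda> j) = k}"

text \<open>
  The real span of the weights of the finite dimensional algebra is coordinatized by the basis of
  fundamental weights \<open>\<Lambda>_1, \<dots>, \<Lambda>_l\<close> (restricted to the finite part). Vectors and matrices are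
  indexed from \<open>0\<close>, so entry \<open>j\<close> is the coefficient of \<open>\<Lambda>_(j+1)\<close>, that is, the pairing with
  \<open>\<alpha>_(j+1)^\<or>\<close>.
\<close>

definition finite_part :: "nat \<Rightarrow> (nat \<Rightarrow> nat) \<Rightarrow> real vec" where
  "finite_part l \<Lambda> = vec l (\<lambda>j. real (\<Lambda> (Suc j)))"

definition rho :: "nat \<Rightarrow> real vec" where
  "rho l = vec l (\<lambda>_. 1)"

definition simple_root :: "(nat \<Rightarrow> nat \<Rightarrow> int) \<Rightarrow> nat \<Rightarrow> nat \<Rightarrow> real vec" where
  "simple_root A l i = vec l (\<lambda>j. of_int (A (Suc j) i))"

text \<open>The matrix of \<open>x \<mapsto> x - \<langle>x, \<alpha>_i^\<or>\<rangle> \<alpha>_i\<close>.\<close>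

definition simple_reflection :: "(nat \<Rightarrow> nat \<Rightarrow> int) \<Rightarrow> nat \<Rightarrow> nat \<Rightarrow> real mat" where
  "simple_reflection A l i =
     mat l l (\<lambda>(r, c). (if r = c then 1 else 0) - (if Suc c = i then simple_root A l i $ r else 0))"

text \<open>The simple reflections are involutions, so the monoid they generate is a group.\<close>

inductive_set weyl_group :: "(nat \<Rightarrow> nat \<Rightarrow> int) \<Rightarrow> nat \<Rightarrow> real mat set"
  for A :: "nat \<Rightarrow> nat \<Rightarrow> int" and l :: nat where
  one: "1\<^sub>m l \<in> weyl_group A l"
| step: "w \<in> weyl_group A l \<Longrightarrow> i \<in> {1..l} \<Longrightarrow> simple_reflection A l i * w \<in> weyl_group A l"

definition roots :: "(nat \<Rightarrow> nat \<Rightarrow> int) \<Rightarrow> nat \<Rightarrow> real vec set" where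
  "roots A l = {w *\<^sub>v simple_root A l i | w i. w \<in> weyl_group A l \<and> i \<in> {1..l}}"

definition bilin :: "real mat \<Rightarrow> real vec \<Rightarrow> real vec \<Rightarrow> real" where
  "bilin G x y = x \<bullet> (G *\<^sub>v y)"

text \<open>
  The Gram matrix of the normalized invariant form: the symmetric bilinear form invariant under the
  Weyl group for which the long roots have square length \<open>2\<close>.
\<close>

definition normalized_form :: "(nat \<Rightarrow> nat \<Rightarrow> int) \<Rightarrow> nat \<Rightarrow> real mat" where
  "normalized_form A l =
     (THE G. G \<in> carrier_mat l l \<and> transpose_mat G = G \<and>
             (\<forall>w\<in>weyl_group A l. \<forall>x\<in>carrier_vec l. \<forall>y\<in>carrier_vec l.
                bilin G (w *\<^sub>v x) (w *\<^sub>v y) = bilin G x y) \<and>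
             Max ((\<lambda>\<alpha>. bilin G \<alpha> \<alpha>) ` roots A l) = 2)"

text \<open>
  The Kac-Peterson matrix is only determined up to the non-zero constant \<open>c\<close>; only its entries
  with indices in \<open>dominant_weights A l k\<close> matter.
\<close>

definition kac_peterson_matrix ::
  "(nat \<Rightarrow> nat \<Rightarrow> int) \<Rightarrow> nat \<Rightarrow> nat \<Rightarrow> ((nat \<Rightarrow> nat) \<Rightarrow> (nat \<Rightarrow> nat) \<Rightarrow> complex) \<Rightarrow> bool" where
  "kac_peterson_matrix A l k S \<longleftrightarrow>
     (\<exists>c. c \<noteq> 0 \<and>
        (\<forall>\<Lambda>\<in>dominant_weights A l k. \<forall>\<Lambda>'\<in>dominant_weights A l k.
           S \<Lambda> \<Lambda>' = c * (\<Sum>w\<in>weyl_group A l. of_real (det w) *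
             exp (- (2 * of_real pi * \<i> *
               of_real (bilin (normalized_form A l)
                 (finite_part l \<Lambda> + rho l) (w *\<^sub>v (finite_part l \<Lambda>' + rho l))) /
               of_nat (k + dual_coxeter_number A l))))))"

text \<open>
  Entries of the \<open>l\<close>-th exterior power of a matrix whose index set is totally ordered by the values
  of \<open>key\<close>, assumed injective on it; \<open>I\<close> and \<open>J\<close> range over \<open>l\<close>-element sets of indices.
\<close>

definition exterior_power ::
  "('i \<Rightarrow> 'o::linorder) \<Rightarrow> nat \<Rightarrow> ('i \<Rightarrow> 'i \<Rightarrow> 'a::comm_ring_1) \<Rightarrow> 'i set \<Rightarrow> 'i set \<Rightarrow> 'a" where
  "exterior_power key l S I J =
     det (mat l l (\<lambda>(\<nu>, \<nu>').
       S (sorted_key_list_of_set key I ! \<nu>) (sorted_key_list_of_set key J ! \<nu>')))"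

end

theory Submission
  imports Defs
begin

text \<open>
  In the orthogonal basis \<open>\<epsilon>_1, \<dots>, \<epsilon>_l\<close> of the weight space of type C the Weyl group consists of the
  signed permutations and the normalized form is half the standard one. In the Weyl group sum, the
  signs in front of each coordinate produce factors \<open>- 2 \<i> sin (\<pi> x_i y_(\<sigma> i) / n)\<close>, and the sum over
  the permutations \<open>\<sigma>\<close> is the determinant of the matrix of these factors. Since the rank one case of
  type C is type A1, single factors are the entries of \<open>S\<close>. The number \<open>n\<close>, level plus dual Coxeter
  number, is \<open>k + l + 1\<close> for both algebras, and the coordinates of \<open>\<Lambda> + \<rho>\<close> run through all strictly
  decreasing sequences of length \<open>l\<close> in \<open>{1..k + l}\<close>, that is, through the \<open>l\<close>-element subsets.
\<close>

subsection \<open>Orthogonal coordinates\<close>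

text \<open>
  Row \<open>i\<close> of \<open>orth_coords l\<close> computes the coefficient of \<open>\<epsilon>_(i+1)\<close> when the fundamental weights are
  \<open>\<Lambda>_j = \<epsilon>_1 + \<dots> + \<epsilon>_j\<close>; the columns of \<open>fund_coords l\<close> are the \<open>\<epsilon>_i\<close> in terms of fundamental
  weights.
\<close>

definition orth_coords :: "nat \<Rightarrow> real mat" where
  "orth_coords l = mat l l (\<lambda>(i, j). if i \<le> j then 1 else 0)"

definition fund_coords :: "nat \<Rightarrow> real mat" where
  "fund_coords l = mat l l (\<lambda>(i, j). (if j = i then 1 else 0) - (if j = Suc i then 1 else 0))"

lemma orth_coords_carrier [simp]: "orth_coords l \<in> carrier_mat l l"
  by (simp add: orth_coords_def)

lemma fund_coords_carrier [simp]: "fund_coords l \<in> carrier_mat l l"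
  by (simp add: fund_coords_def)

lemma dim_coords [simp]:
  "dim_row (orth_coords l) = l" "dim_col (orth_coords l) = l"
  "dim_row (fund_coords l) = l" "dim_col (fund_coords l) = l"
  by (simp_all add: orth_coords_def fund_coords_def)

lemma fund_coords_index:
  "r < l \<Longrightarrow> c < l \<Longrightarrow> fund_coords l $$ (r, c) = (if c = r then 1 else 0) - (if c = Suc r then 1 else 0)"
  by (simp add: fund_coords_def)

lemma fund_coords_mult_index:
  assumes "X \<in> carrier_mat l n" "r < l" "c < n"
  shows "(fund_coords l * X) $$ (r, c) = X $$ (r, c) - (if Suc r < l then X $$ (Suc r, c) else 0)"
  using assms
  by (simp add: fund_coords_def scalar_prod_def left_diff_distrib sum_subtractf sum.delta'
      if_distrib[of "\<lambda>x. x * _"] cong: if_cong)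

lemma fund_coords_mult_vec_index:
  assumes "v \<in> carrier_vec l" "r < l"
  shows "(fund_coords l *\<^sub>v v) $ r = v $ r - (if Suc r < l then v $ Suc r else 0)"
  using assms
  by (simp add: fund_coords_def scalar_prod_def left_diff_distrib sum_subtractf sum.delta'
      if_distrib[of "\<lambda>x. x * _"] cong: if_cong)

lemma fund_orth_coords [simp]: "fund_coords l * orth_coords l = 1\<^sub>m l"
proof (rule eq_matI)
  fix i j assume "i < dim_row (1\<^sub>m l)" "j < dim_col (1\<^sub>m l)"
  then show "(fund_coords l * orth_coords l) $$ (i, j) = 1\<^sub>m l $$ (i, j)"
    by (subst fund_coords_mult_index[of _ l l]) (auto simp: orth_coords_def)
qed auto

lemma orth_fund_coords [simp]: "orth_coords l * fund_coords l = 1\<^sub>m l"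
  by (rule mat_mult_left_right_inverse[of _ l]) auto

lemma orth_coords_mult_vec_fund [simp]:
  "v \<in> carrier_vec l \<Longrightarrow> orth_coords l *\<^sub>v (fund_coords l *\<^sub>v v) = v"
  by (simp flip: assoc_mult_mat_vec[of _ l l _ l])

lemma fund_coords_mult_vec_orth [simp]:
  "v \<in> carrier_vec l \<Longrightarrow> fund_coords l *\<^sub>v (orth_coords l *\<^sub>v v) = v"
  by (simp flip: assoc_mult_mat_vec[of _ l l _ l])

text \<open>The change of basis from orthogonal to fundamental weight coordinates. Being conjugation
  by mutually inverse matrices, it is injective and preserves products and determinants, so the Weyl
  group can be studied on signed permutations.\<close>

definition from_orth :: "nat \<Rightarrow> real mat \<Rightarrow> real mat" where
  "from_orth l M = fund_coords l * M * orth_coords l"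

lemma from_orth_carrier [simp]: "M \<in> carrier_mat l l \<Longrightarrow> from_orth l M \<in> carrier_mat l l"
  by (simp add: from_orth_def mult_carrier_mat[of _ l l])

lemma orth_coords_from_orth:
  assumes "M \<in> carrier_mat l l"
  shows "orth_coords l * from_orth l M = M * orth_coords l"
proof -
  have "orth_coords l * from_orth l M = orth_coords l * (fund_coords l * (M * orth_coords l))"
    using assms by (simp add: from_orth_def assoc_mult_mat[of _ l l _ l _ l])
  also have "\<dots> = (orth_coords l * fund_coords l) * (M * orth_coords l)"
    using assms by (intro assoc_mult_mat[symmetric, of _ l l _ l _ l]) auto
  finally show ?thesis
    using assms by (simp add: left_mult_one_mat[of _ l l])
qed

lemma from_orth_mult:
  assumes "M \<in> carrier_mat l l" "N \<in> carrier_mat l l"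
  shows "from_orth l M * from_orth l N = from_orth l (M * N)"
proof -
  have "from_orth l M * from_orth l N = fund_coords l * M * (orth_coords l * from_orth l N)"
    using assms unfolding from_orth_def[of l M]
    by (intro assoc_mult_mat[of _ l l _ l _ l]) (auto simp: mult_carrier_mat[of _ l l])
  also have "\<dots> = fund_coords l * M * (N * orth_coords l)"
    using assms by (simp add: orth_coords_from_orth)
  also have "\<dots> = from_orth l (M * N)"
    using assms by (simp add: from_orth_def assoc_mult_mat[of _ l l _ l _ l]
        mult_carrier_mat[of _ l l])
  finally show ?thesis .
qed

lemma from_orth_mult_vec:
  assumes "M \<in> carrier_mat l l" "x \<in> carrier_vec l"
  shows "orth_coords l *\<^sub>v (from_orth l M *\<^sub>v x) = M *\<^sub>v (orth_coords l *\<^sub>v x)"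
proof -
  have "orth_coords l *\<^sub>v (from_orth l M *\<^sub>v x) = (orth_coords l * from_orth l M) *\<^sub>v x"
    using assms by (intro assoc_mult_mat_vec[symmetric, of _ l l _ l]) auto
  also have "\<dots> = M *\<^sub>v (orth_coords l *\<^sub>v x)"
    using assms by (simp add: orth_coords_from_orth assoc_mult_mat_vec[of _ l l _ l])
  finally show ?thesis .
qed

lemma from_orth_inject:
  assumes "M \<in> carrier_mat l l" "N \<in> carrier_mat l l" "from_orth l M = from_orth l N"
  shows "M = N"
proof -
  have "M * orth_coords l * fund_coords l = N * orth_coords l * fund_coords l"
    using assms(3) assms(1,2)[THEN orth_coords_from_orth] by simp
  then show ?thesis
    using assms by (simp add: assoc_mult_mat[of _ l l _ l _ l])
qed

lemma det_from_orth:
  assumes "M \<in> carrier_mat l l"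
  shows "det (from_orth l M) = det M"
proof -
  have "det (orth_coords l) * det (fund_coords l) = 1"
    using det_mult[of "orth_coords l" l "fund_coords l"] by simp
  then show ?thesis
    using assms
    by (simp add: from_orth_def det_mult[of _ l] mult_carrier_mat[of _ l l] mult_ac)
qed

subsection \<open>Signed permutation matrices\<close>

text \<open>Row \<open>i\<close> carries its sign in column \<open>p i\<close>, so the matrix moves
  coordinate \<open>p i\<close> to place \<open>i\<close>. With this convention products reverse the
  order of the permutations.\<close>

definition signed_perm_mat :: "nat \<Rightarrow> (nat \<Rightarrow> nat) \<Rightarrow> (nat \<Rightarrow> real) \<Rightarrow> real mat" where
  "signed_perm_mat l p \<epsilon> = mat l l (\<lambda>(i, j). if j = p i then \<epsilon> i else 0)"

definition signed_perm_mats :: "nat \<Rightarrow> real mat set" where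
  "signed_perm_mats l =
     {signed_perm_mat l p \<epsilon> | p \<epsilon>. p permutes {0..<l} \<and> (\<forall>i<l. \<epsilon> i \<in> {1, - 1})}"

lemma signed_perm_mat_carrier [simp]: "signed_perm_mat l p \<epsilon> \<in> carrier_mat l l"
  by (simp add: signed_perm_mat_def)

lemma dim_signed_perm_mat [simp]:
  "dim_row (signed_perm_mat l p \<epsilon>) = l" "dim_col (signed_perm_mat l p \<epsilon>) = l"
  by (simp_all add: signed_perm_mat_def)

lemma permutes_lt: "p permutes {0..<l} \<Longrightarrow> i < l \<Longrightarrow> p i < (l::nat)"
  using permutes_in_image[of p "{0..<l}" i] by simp

lemma signed_perm_mat_mult:
  assumes "p permutes {0..<l}"
  shows "signed_perm_mat l p \<epsilon> * signed_perm_mat l q \<eta> =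
    signed_perm_mat l (q \<circ> p) (\<lambda>i. \<epsilon> i * \<eta> (p i))"
  using permutes_lt[OF assms]
  by (intro eq_matI) (auto simp: signed_perm_mat_def scalar_prod_def
      if_distrib[of "\<lambda>x. x * _"] cong: if_cong)

lemma signed_perm_mat_mult_vec:
  assumes "p permutes {0..<l}" "v \<in> carrier_vec l" "i < l"
  shows "(signed_perm_mat l p \<epsilon> *\<^sub>v v) $ i = \<epsilon> i * v $ p i"
  using permutes_lt[OF assms(1,3)] assms
  by (simp add: signed_perm_mat_def scalar_prod_def if_distrib[of "\<lambda>x. x * _"] cong: if_cong)

lemma signed_perm_mat_cong:
  "(\<And>i. i < l \<Longrightarrow> p i = q i) \<Longrightarrow> (\<And>i. i < l \<Longrightarrow> \<epsilon> i = \<eta> i) \<Longrightarrow>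
    signed_perm_mat l p \<epsilon> = signed_perm_mat l q \<eta>"
  by (intro eq_matI) (auto simp: signed_perm_mat_def)

lemma signed_perm_mat_id: "signed_perm_mat l id (\<lambda>_. 1) = 1\<^sub>m l"
  by (intro eq_matI) (auto simp: signed_perm_mat_def)

text \<open>In the Leibniz expansion every permutation other than \<open>p\<close> meets a zero
  entry, so a single term is left.\<close>

lemma det_signed_perm_mat:
  assumes p: "p permutes {0..<l}"
  shows "det (signed_perm_mat l p \<epsilon>) = signof p * (\<Prod>i<l. \<epsilon> i)"
proof -
  have "(\<Prod>i = 0..<l. signed_perm_mat l p \<epsilon> $$ (i, q i)) = 0"
    if q: "q permutes {0..<l}" "q \<noteq> p" for q
  proof -
    obtain i where "q i \<noteq> p i"
      using q(2) by auto
    moreover from this have "i < l"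
      using q p by (metis atLeastLessThan_iff not_le permutes_not_in zero_le)
    ultimately show ?thesis
      using permutes_lt[OF q(1)] by (intro prod_zero) (auto simp: signed_perm_mat_def)
  qed
  then have "det (signed_perm_mat l p \<epsilon>) =
      (\<Sum>q\<in>{p}. signof q * (\<Prod>i = 0..<l. signed_perm_mat l p \<epsilon> $$ (i, q i)))"
    unfolding det_def'[OF signed_perm_mat_carrier]
    using p by (intro sum.mono_neutral_right) (auto simp: finite_permutations)
  also have "(\<Prod>i = 0..<l. signed_perm_mat l p \<epsilon> $$ (i, p i)) = (\<Prod>i<l. \<epsilon> i)"
    using permutes_lt[OF p] by (intro prod.cong) (auto simp: signed_perm_mat_def)
  ultimately show ?thesis
    by simp
qed

text \<open>The entry at \<open>(i, p i)\<close> is non-zero, which pins down both the permutation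
  and the sign. Taking the signs as extensional functions turns agreement below \<open>l\<close>
  into equality.\<close>

lemma signed_perm_mat_inject:
  assumes p: "p permutes {0..<l}" and q: "q permutes {0..<l}"
    and \<epsilon>: "\<epsilon> \<in> {0..<l} \<rightarrow>\<^sub>E {1, - 1}" and \<eta>: "\<eta> \<in> {0..<l} \<rightarrow>\<^sub>E {1, - 1}"
    and eq: "signed_perm_mat l p \<epsilon> = signed_perm_mat l q \<eta>"
  shows "p = q \<and> \<epsilon> = \<eta>"
proof -
  have *: "p i = q i \<and> \<epsilon> i = \<eta> i" if i: "i < l" for i
  proof -
    have "signed_perm_mat l p \<epsilon> $$ (i, p i) = signed_perm_mat l q \<eta> $$ (i, p i)"
      by (simp add: eq)
    moreover have "\<epsilon> i \<noteq> 0"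
      using PiE_mem[OF \<epsilon>, of i] i by auto
    ultimately show ?thesis
      using i permutes_lt[OF p i] by (auto simp: signed_perm_mat_def split: if_splits)
  qed
  have "p i = q i" for i
    using * p q by (cases "i < l") (auto simp: permutes_not_in)
  moreover have "\<epsilon> = \<eta>"
    using * by (intro PiE_ext[OF \<epsilon> \<eta>]) auto
  ultimately show ?thesis
    by auto
qed

text \<open>Extensional sign functions remove the freedom of \<open>\<epsilon>\<close> beyond
  \<open>l\<close>, so this parametrization has no repetitions and can reindex sums.\<close>

lemma signed_perm_mats_eq_image:
  "signed_perm_mats l = (\<lambda>(p, \<epsilon>). signed_perm_mat l p \<epsilon>) `
     ({p. p permutes {0..<l}} \<times> ({0..<l} \<rightarrow>\<^sub>E {1, - 1}))"
proof (intro equalityI subsetI)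
  fix M assume "M \<in> signed_perm_mats l"
  then obtain p \<epsilon> where *: "M = signed_perm_mat l p \<epsilon>" "p permutes {0..<l}"
      "\<forall>i<l. \<epsilon> i \<in> {1, - 1}"
    by (auto simp: signed_perm_mats_def)
  then have "M = signed_perm_mat l p (restrict \<epsilon> {0..<l})"
    by (auto intro: signed_perm_mat_cong)
  moreover have "restrict \<epsilon> {0..<l} \<in> {0..<l} \<rightarrow>\<^sub>E {1, - 1}"
    using * by auto
  ultimately show "M \<in> (\<lambda>(p, \<epsilon>). signed_perm_mat l p \<epsilon>) `
     ({p. p permutes {0..<l}} \<times> ({0..<l} \<rightarrow>\<^sub>E {1, - 1}))"
    using * by blast
next
  fix M assume "M \<in> (\<lambda>(p, \<epsilon>). signed_perm_mat l p \<epsilon>) `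
     ({p. p permutes {0..<l}} \<times> ({0..<l} \<rightarrow>\<^sub>E {1, - 1}))"
  then obtain p \<epsilon> where *: "M = signed_perm_mat l p \<epsilon>" "p permutes {0..<l}"
      "\<epsilon> \<in> {0..<l} \<rightarrow>\<^sub>E {1, - 1}"
    by auto
  have "\<forall>i<l. \<epsilon> i \<in> {1, - 1}"
    by (intro allI impI PiE_mem[OF *(3)]) auto
  with * show "M \<in> signed_perm_mats l"
    unfolding signed_perm_mats_def by blast
qed

lemma signed_perm_mats_carrier: "M \<in> signed_perm_mats l \<Longrightarrow> M \<in> carrier_mat l l"
  by (auto simp: signed_perm_mats_def)

lemma signed_perm_mats_mult:
  assumes "M \<in> signed_perm_mats l" "N \<in> signed_perm_mats l"
  shows "M * N \<in> signed_perm_mats l"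
proof -
  obtain p \<epsilon> q \<eta> where *: "M = signed_perm_mat l p \<epsilon>" "p permutes {0..<l}" "\<forall>i<l. \<epsilon> i \<in> {1, - 1}"
      "N = signed_perm_mat l q \<eta>" "q permutes {0..<l}" "\<forall>i<l. \<eta> i \<in> {1, - 1}"
    using assms by (auto simp: signed_perm_mats_def)
  have "M * N = signed_perm_mat l (q \<circ> p) (\<lambda>i. \<epsilon> i * \<eta> (p i))"
    using * by (simp add: signed_perm_mat_mult)
  moreover have "(q \<circ> p) permutes {0..<l}"
    using * by (simp add: permutes_compose)
  moreover have "\<epsilon> i * \<eta> (p i) \<in> {1, - 1}" if "i < l" for i
    using *(3,6) that permutes_lt[OF *(2) that] by fastforce
  ultimately show ?thesis
    unfolding signed_perm_mats_def by blast
qed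

lemma signed_perm_mat_in_mats:
  "p permutes {0..<l} \<Longrightarrow> (\<And>i. i < l \<Longrightarrow> \<epsilon> i \<in> {1, - 1}) \<Longrightarrow>
    signed_perm_mat l p \<epsilon> \<in> signed_perm_mats l"
  unfolding signed_perm_mats_def by blast

subsection \<open>The Weyl group of type C\<close>

text \<open>Indicator terms let the sums over a column split into single summands. The bound
  \<open>l \<ge> 1\<close> keeps the rank one case, where both off-diagonal entries are
  \<open>- 2\<close>.\<close>

lemma cartan_C_affine_alt:
  assumes "l \<ge> 1"
  shows "cartan_C_affine l i j = (if i = j then 2 else 0)
    - (if i = Suc j then if j = 0 then 2 else 1 else 0)
    - (if Suc i = j then if j = l then 2 else 1 else 0)"
  using assms by (auto simp: cartan_C_affine_def)

abbreviation C_simple_root :: "nat \<Rightarrow> nat \<Rightarrow> real vec" where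
  "C_simple_root l \<equiv> simple_root (cartan_C_affine l) l"

text \<open>The simple roots of type C: \<open>\<epsilon>_i - \<epsilon>_(i+1)\<close> for
  \<open>i < l\<close>, and the long root \<open>2 \<epsilon>_l\<close>.\<close>

definition orth_root :: "nat \<Rightarrow> nat \<Rightarrow> real vec" where
  "orth_root l i = vec l (\<lambda>r. if i < l then (if Suc r = i then 1 else 0) - (if r = i then 1 else 0)
     else if Suc r = l then 2 else 0)"

lemma orth_root_carrier [simp]: "orth_root l i \<in> carrier_vec l"
  by (simp add: orth_root_def)

lemma fund_coords_orth_root:
  assumes "i \<in> {1..l}"
  shows "fund_coords l *\<^sub>v orth_root l i = C_simple_root l i"
proof (rule eq_vecI)
  fix r assume "r < dim_vec (C_simple_root l i)"
  then have r: "r < l"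
    by (simp add: simple_root_def)
  show "(fund_coords l *\<^sub>v orth_root l i) $ r = C_simple_root l i $ r"
    using r assms by (subst fund_coords_mult_vec_index)
      (auto simp: orth_root_def simple_root_def cartan_C_affine_alt)
qed (simp add: simple_root_def)

text \<open>The reflection in \<open>orth_root l i\<close>, written directly as a signed permutation
  so that membership in \<open>signed_perm_mats\<close> is immediate.\<close>

definition orth_reflection :: "nat \<Rightarrow> nat \<Rightarrow> real mat" where
  "orth_reflection l i = (if i < l then signed_perm_mat l (transpose (i - 1) i) (\<lambda>_. 1)
     else signed_perm_mat l id (\<lambda>r. if Suc r = l then - 1 else 1))"

lemma orth_reflection_in_mats:
  "i \<in> {1..l} \<Longrightarrow> orth_reflection l i \<in> signed_perm_mats l"
  by (auto simp: orth_reflection_def permutes_id split: if_splits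
      intro!: signed_perm_mat_in_mats permutes_swap_id)

lemma orth_reflection_carrier [simp]: "orth_reflection l i \<in> carrier_mat l l"
  by (simp add: orth_reflection_def)

lemma dim_orth_reflection [simp]:
  "dim_row (orth_reflection l i) = l" "dim_col (orth_reflection l i) = l"
  by (simp_all add: orth_reflection_def)

lemma simple_reflection_carrier [simp]: "simple_reflection A l i \<in> carrier_mat l l"
  by (simp add: simple_reflection_def)

abbreviation C_weyl_group :: "nat \<Rightarrow> real mat set" where
  "C_weyl_group l \<equiv> weyl_group (cartan_C_affine l) l"

text \<open>Both sides are compared after multiplication by \<open>fund_coords l\<close> on the
  right, which is then cancelled by its inverse \<open>orth_coords l\<close>.\<close>

lemma simple_reflection_C:
  assumes i: "i \<in> {1..l}"
  shows "simple_reflection (cartan_C_affine l) l i = from_orth l (orth_reflection l i)"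
proof -
  let ?s = "simple_reflection (cartan_C_affine l) l i"
  let ?F = "fund_coords l" and ?R = "orth_reflection l i"
  have root: "C_simple_root l i $ r = orth_root l i $ r - (if Suc r < l then orth_root l i $ Suc r else 0)"
    if "r < l" for r
    using that fund_coords_mult_vec_index[of "orth_root l i" l r] fund_coords_orth_root[OF i] by simp
  \<comment> \<open>Row \<open>i - 1\<close> of \<open>fund_coords l\<close> is the simple coroot in
    orthogonal coordinates, so this is the reflection formula, root times coroot subtracted from the
    identity.\<close>
  have refl: "?R $$ (r, c) = (if r = c then 1 else 0) - orth_root l i $ r * ?F $$ (i - 1, c)"
    if "r < l" "c < l" for r c
  proof (cases "i < l")
    case True
    with that i show ?thesis
      by (cases i) (auto simp: orth_reflection_def signed_perm_mat_def orth_root_def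
          fund_coords_def transpose_def)
  next
    case False
    with that i show ?thesis
      by (auto simp: orth_reflection_def signed_perm_mat_def orth_root_def fund_coords_def)
  qed
  have "?s * ?F = ?F * ?R"
  proof (rule eq_matI)
    fix r c assume "r < dim_row (?F * ?R)" "c < dim_col (?F * ?R)"
    then have r: "r < l" and c: "c < l"
      by auto
    have "(?s * ?F) $$ (r, c) = ?F $$ (r, c) - C_simple_root l i $ r * ?F $$ (i - 1, c)"
    proof -
      have "(?s * ?F) $$ (r, c) =
        (\<Sum>m = 0..<l. (if m = r then ?F $$ (m, c) else 0)
          - (if m = i - 1 then C_simple_root l i $ r * ?F $$ (m, c) else 0))"
        using r c i unfolding simple_reflection_def
        by (auto simp: scalar_prod_def left_diff_distrib intro!: sum.cong)
      also have "\<dots> = ?F $$ (r, c) - C_simple_root l i $ r * ?F $$ (i - 1, c)"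
        using r c i by (auto simp: sum_subtractf)
      finally show ?thesis .
    qed
    also have "\<dots> = (?F * ?R) $$ (r, c)"
      using r c
      by (subst fund_coords_mult_index[of _ l l])
         (auto simp: fund_coords_index refl root algebra_simps)
    finally show "(?s * ?F) $$ (r, c) = (?F * ?R) $$ (r, c)" .
  qed (simp_all add: simple_reflection_def)
  then have "?s * (?F * orth_coords l) = ?F * ?R * orth_coords l"
    by (subst assoc_mult_mat[symmetric, of _ l l _ l _ l]) auto
  then show ?thesis
    by (simp add: from_orth_def right_mult_one_mat[of _ l l])
qed

lemma weyl_group_carrier: "w \<in> weyl_group A l \<Longrightarrow> w \<in> carrier_mat l l"
  by (induction rule: weyl_group.induct) (auto simp: mult_carrier_mat[of _ l l])

lemma weyl_group_mult:
  assumes "w \<in> weyl_group A l" "v \<in> weyl_group A l"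
  shows "w * v \<in> weyl_group A l"
  using assms(1)
proof (induction rule: weyl_group.induct)
  case one
  then show ?case
    using assms(2) weyl_group_carrier[OF assms(2)] by simp
next
  case (step w i)
  then have "simple_reflection A l i * w * v = simple_reflection A l i * (w * v)"
    using weyl_group_carrier[OF step(1)] weyl_group_carrier[OF assms(2)]
    by (simp add: assoc_mult_mat[of _ l l _ l _ l])
  with step show ?case
    by (simp add: weyl_group.step)
qed

lemma simple_reflection_in_weyl_group:
  "i \<in> {1..l} \<Longrightarrow> simple_reflection A l i \<in> weyl_group A l"
  using weyl_group.step[OF weyl_group.one, of i l A]
  by (simp add: right_mult_one_mat[of _ l l])

lemma from_orth_one: "from_orth l (1\<^sub>m l) = 1\<^sub>m l"
  by (simp add: from_orth_def right_mult_one_mat[of _ l l])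

lemma id_in_C_weyl_group: "from_orth l (signed_perm_mat l id (\<lambda>_. 1)) \<in> C_weyl_group l"
  unfolding signed_perm_mat_id from_orth_one by (rule weyl_group.one)

lemma C_weyl_group_subset: "C_weyl_group l \<subseteq> from_orth l ` signed_perm_mats l"
proof
  fix w assume "w \<in> C_weyl_group l"
  then show "w \<in> from_orth l ` signed_perm_mats l"
  proof (induction rule: weyl_group.induct)
    case one
    have "1\<^sub>m l \<in> signed_perm_mats l"
      unfolding signed_perm_mat_id[symmetric] by (intro signed_perm_mat_in_mats permutes_id) simp
    then show ?case
      by (metis from_orth_one imageI)
  next
    case (step w i)
    then obtain M where M: "M \<in> signed_perm_mats l" "w = from_orth l M"
      by auto
    have "simple_reflection (cartan_C_affine l) l i * w = from_orth l (orth_reflection l i * M)"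
      using step M signed_perm_mats_carrier[OF M(1)]
      by (simp add: simple_reflection_C from_orth_mult)
    moreover have "orth_reflection l i * M \<in> signed_perm_mats l"
      using step M by (intro signed_perm_mats_mult orth_reflection_in_mats) auto
    ultimately show ?case
      by blast
  qed
qed

lemma from_orth_mult_in_C_weyl_group:
  assumes "M \<in> carrier_mat l l" "N \<in> carrier_mat l l"
    and "from_orth l M \<in> C_weyl_group l" "from_orth l N \<in> C_weyl_group l"
  shows "from_orth l (M * N) \<in> C_weyl_group l"
  using weyl_group_mult[OF assms(3,4)] from_orth_mult[OF assms(1,2)] by simp

lemma orth_reflection_in_C_weyl_group:
  "i \<in> {1..l} \<Longrightarrow> from_orth l (orth_reflection l i) \<in> C_weyl_group l"
  using simple_reflection_in_weyl_group[of i l "cartan_C_affine l"] by (simp add: simple_reflection_C)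

section \<open>Generating all signed permutations from the simple reflections\<close>

text \<open>Induction on the distance: the transposition of \<open>a\<close> and
  \<open>n + 1\<close> is the one of \<open>a\<close> and \<open>n\<close> conjugated by the
  adjacent swap of \<open>n\<close> and \<open>n + 1\<close>.\<close>

lemma transpose_in_C_weyl_group_aux:
  assumes "b < l" "a \<le> b"
  shows "from_orth l (signed_perm_mat l (transpose a b) (\<lambda>_. 1)) \<in> C_weyl_group l"
  using assms(2,1)
proof (induction rule: dec_induct)
  case base
  then show ?case
    by (simp add: id_in_C_weyl_group[unfolded id_def])
next
  case (step n)
  let ?T = "\<lambda>p. signed_perm_mat l p (\<lambda>_. 1)"
  have adj: "from_orth l (?T (transpose n (Suc n))) \<in> C_weyl_group l"
    using orth_reflection_in_C_weyl_group[of "Suc n" l] step by (simp add: orth_reflection_def)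
  have perm: "transpose n (Suc n) permutes {0..<l}" "transpose a n permutes {0..<l}"
    using step by (auto intro!: permutes_swap_id)
  show ?case
  \<comment> \<open>For \<open>n = a\<close> the conjugation would yield the identity; there the
    adjacent swap itself is the required transposition.\<close>
  proof (cases "n = a")
    case True
    with adj show ?thesis
      by simp
  next
    case False
    have "?T (transpose a (Suc n)) =
        ?T (transpose n (Suc n)) * (?T (transpose a n) * ?T (transpose n (Suc n)))"
      using perm step False
      by (auto simp: signed_perm_mat_mult permutes_compose intro!: signed_perm_mat_cong)
         (auto simp: transpose_def)
    then show ?thesis
      using adj step by (auto intro!: from_orth_mult_in_C_weyl_group mult_carrier_mat[of _ l l])
  qed
qed

lemma transpose_in_C_weyl_group:
  assumes "a < l" "b < l"
  shows "from_orth l (signed_perm_mat l (transpose a b) (\<lambda>_. 1)) \<in> C_weyl_group l"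
proof (cases "a \<le> b")
  case False
  then show ?thesis
    using transpose_in_C_weyl_group_aux[of a l b] assms by (simp add: transpose_commute)
qed (use transpose_in_C_weyl_group_aux assms in auto)

lemma perm_in_C_weyl_group:
  assumes "p permutes {0..<l}"
  shows "from_orth l (signed_perm_mat l p (\<lambda>_. 1)) \<in> C_weyl_group l"
  using assms finite_atLeastLessThan
proof (induction rule: permutes_induct)
  case id
  then show ?case
    by (rule id_in_C_weyl_group)
next
  case (swap a b p)
  \<comment> \<open>Products reverse composition, so the new transposition enters on the
    right.\<close>
  have "signed_perm_mat l (transpose a b \<circ> p) (\<lambda>_. 1) =
      signed_perm_mat l p (\<lambda>_. 1) * signed_perm_mat l (transpose a b) (\<lambda>_. 1)"
    using swap by (simp add: signed_perm_mat_mult)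
  moreover have "from_orth l (signed_perm_mat l (transpose a b) (\<lambda>_. 1)) \<in> C_weyl_group l"
    using swap by (intro transpose_in_C_weyl_group) auto
  ultimately show ?case
    using swap by (simp only: from_orth_mult_in_C_weyl_group signed_perm_mat_carrier)
qed

text \<open>The reflection in the long simple root negates the last coordinate; conjugation by the
  swap of \<open>j\<close> and \<open>l - 1\<close> moves the sign to \<open>j\<close>.\<close>

lemma sign_change_in_C_weyl_group:
  assumes "j < l"
  shows "from_orth l (signed_perm_mat l id (\<lambda>i. if i = j then - 1 else 1)) \<in> C_weyl_group l"
proof -
  let ?t = "signed_perm_mat l (transpose j (l - 1)) (\<lambda>_. 1)"
  have perm: "transpose j (l - 1) permutes {0..<l}"
    using assms by (auto intro!: permutes_swap_id)
  have "signed_perm_mat l id (\<lambda>i. if i = j then - 1 else 1) = ?t * (orth_reflection l l * ?t)"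
    using assms perm
    by (auto simp: orth_reflection_def signed_perm_mat_mult permutes_id intro!: signed_perm_mat_cong)
       (auto simp: transpose_def split: if_splits)
  moreover have "from_orth l (orth_reflection l l) \<in> C_weyl_group l"
    using assms by (intro orth_reflection_in_C_weyl_group) auto
  ultimately show ?thesis
    using assms transpose_in_C_weyl_group[of j l "l - 1"]
    by (auto intro!: from_orth_mult_in_C_weyl_group mult_carrier_mat[of _ l l])
qed

lemma signs_in_C_weyl_group:
  assumes "E \<subseteq> {0..<l}"
  shows "from_orth l (signed_perm_mat l id (\<lambda>i. if i \<in> E then - 1 else 1)) \<in> C_weyl_group l"
  using finite_subset[OF assms finite_atLeastLessThan] assms
proof (induction rule: finite_induct)
  case empty
  then show ?case
    using id_in_C_weyl_group[of l] by (simp add: id_def)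
next
  case (insert j E)
  have "signed_perm_mat l id (\<lambda>i. if i \<in> insert j E then - 1 else 1) =
      signed_perm_mat l id (\<lambda>i. if i = j then - 1 else 1) *
      signed_perm_mat l id (\<lambda>i. if i \<in> E then - 1 else 1)"
    using insert by (auto simp: signed_perm_mat_mult permutes_id intro!: signed_perm_mat_cong)
  moreover have "from_orth l (signed_perm_mat l id (\<lambda>i. if i = j then - 1 else 1)) \<in> C_weyl_group l"
    using insert by (intro sign_change_in_C_weyl_group) auto
  ultimately show ?case
    using insert by (simp only: from_orth_mult_in_C_weyl_group signed_perm_mat_carrier insert_subset)
qed

lemma C_weyl_group_eq: "C_weyl_group l = from_orth l ` signed_perm_mats l"
proof
  show "from_orth l ` signed_perm_mats l \<subseteq> C_weyl_group l"
  proof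
    fix w assume "w \<in> from_orth l ` signed_perm_mats l"
    then obtain p \<epsilon> where *: "w = from_orth l (signed_perm_mat l p \<epsilon>)" "p permutes {0..<l}"
        "\<forall>i<l. \<epsilon> i \<in> {1, - 1}"
      by (auto simp: signed_perm_mats_def)
    \<comment> \<open>A signed permutation splits into a change of signs, recorded by the set of
      negated places, and a pure permutation.\<close>
    let ?E = "{i \<in> {0..<l}. \<epsilon> i = - 1}"
    have "signed_perm_mat l p \<epsilon> =
        signed_perm_mat l id (\<lambda>i. if i \<in> ?E then - 1 else 1) * signed_perm_mat l p (\<lambda>_. 1)"
      using *(3) by (auto simp: signed_perm_mat_mult permutes_id intro!: signed_perm_mat_cong)
    then show "w \<in> C_weyl_group l"
      unfolding *(1)
      using signs_in_C_weyl_group[of ?E l, OF Collect_subset] perm_in_C_weyl_group[OF *(2)]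
      by (auto intro!: from_orth_mult_in_C_weyl_group)
  qed
qed (rule C_weyl_group_subset)

subsection \<open>Dual Kac labels\<close>

text \<open>The equations for the columns \<open>j < l\<close> force all labels to equal the one of
  node \<open>0\<close>, and coprimality makes the common value \<open>1\<close>.\<close>

lemma dual_kac_labels_C:
  assumes l: "l \<ge> 1"
  shows "dual_kac_labels (cartan_C_affine l) l = (\<lambda>i. if i \<le> l then 1 else 0)"
proof -
  have column: "(\<Sum>i\<le>l. int (a i) * cartan_C_affine l i j) =
      2 * int (a j) - (if j < l then (if j = 0 then 2 else 1) * int (a (Suc j)) else 0)
      - (if j > 0 then (if j = l then 2 else 1) * int (a (j - 1)) else 0)"
    if "j \<le> l" for a j
  proof -
    have "(\<Sum>i\<le>l. int (a i) * cartan_C_affine l i j) =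
      (\<Sum>i\<le>l. (if i = j then 2 * int (a i) else 0)
        - (if i = Suc j then (if j = 0 then 2 else 1) * int (a i) else 0)
        - (if i = j - 1 \<and> j > 0 then (if j = l then 2 else 1) * int (a i) else 0))"
      by (intro sum.cong) (auto simp: cartan_C_affine_alt[OF l])
    also have "\<dots> = 2 * int (a j) - (if j < l then (if j = 0 then 2 else 1) * int (a (Suc j)) else 0)
      - (if j > 0 then (if j = l then 2 else 1) * int (a (j - 1)) else 0)"
      using that by (cases "j > 0") (auto simp: sum_subtractf)
    finally show ?thesis .
  qed
  show ?thesis
    unfolding dual_kac_labels_def
  proof (rule the_equality, intro conjI allI impI)
    fix j assume "j \<le> l"
    then show "(\<Sum>i\<le>l. int (if i \<le> l then 1 else 0) * cartan_C_affine l i j) = 0"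
      using l column[of j "\<lambda>i. if i \<le> l then 1 else 0"] by (auto split: if_splits)
  next
    have "(\<lambda>i. if i \<le> l then 1 else 0) ` {..l} = {1::nat}"
      by auto
    then show "Gcd ((\<lambda>i. if i \<le> l then 1 else 0::nat) ` {..l}) = 1"
      by simp
  next
    fix a :: "nat \<Rightarrow> nat"
    assume a: "(\<forall>i\<le>l. 0 < a i) \<and> (\<forall>i>l. a i = 0) \<and>
      (\<forall>j\<le>l. (\<Sum>i\<le>l. int (a i) * cartan_C_affine l i j) = 0) \<and> Gcd (a ` {..l}) = 1"
    have const: "i \<le> l \<Longrightarrow> a i = a 0" for i
    proof (induction i rule: less_induct)
      case (less i)
      show ?case
      proof (cases i)
        case (Suc j)
        \<comment> \<open>Column \<open>j\<close> is a second order recurrence giving label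
          \<open>j + 1\<close> from the two before it; at \<open>j = 0\<close> it relates only two
          labels.\<close>
        with less.prems a column[of j a] have
          "2 * int (a j) - (if j = 0 then 2 else 1) * int (a i) - (if j > 0 then int (a (j - 1)) else 0) = 0"
          by auto
        moreover have "a j = a 0" "a (j - 1) = a 0"
          using Suc less.prems by (auto intro!: less.IH)
        ultimately show ?thesis
          by (cases "j = 0") auto
      qed simp
    qed
    have "a ` {..l} = (\<lambda>_. a 0) ` {..l}"
      by (intro image_cong refl const) simp
    with a have "a 0 = 1"
      by (simp add: image_constant_conv)
    then have "a i = 1" if "i \<le> l" for i
      using const[OF that] by simp
    with a show "a = (\<lambda>i. if i \<le> l then 1 else 0)"
      by (auto simp: fun_eq_iff)
  qed auto
qed

lemma dual_coxeter_number_C: "l \<ge> 1 \<Longrightarrow> dual_coxeter_number (cartan_C_affine l) l = Suc l"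
  by (simp add: dual_coxeter_number_def dual_kac_labels_C)

lemma dominant_weights_C:
  "l \<ge> 1 \<Longrightarrow> dominant_weights (cartan_C_affine l) l k =
    {\<Lambda>. (\<forall>j>l. \<Lambda> j = 0) \<and> (\<Sum>j\<le>l. \<Lambda> j) = k}"
  by (simp add: dominant_weights_def dual_kac_labels_C)

subsection \<open>The normalized invariant form of type C\<close>

text \<open>The Gram matrix, in fundamental weights, of \<open>g\<close> times the standard scalar
  product of the orthogonal coordinates.\<close>

definition orth_form :: "nat \<Rightarrow> real \<Rightarrow> real mat" where
  "orth_form l g = g \<cdot>\<^sub>m (transpose_mat (orth_coords l) * orth_coords l)"

lemma orth_form_carrier [simp]: "orth_form l g \<in> carrier_mat l l"
  by (simp add: orth_form_def mult_carrier_mat[of _ l l])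

lemma scalar_prod_mult_mat_vec:
  fixes M :: "'a :: comm_semiring_0 mat"
  assumes "M \<in> carrier_mat n m" "x \<in> carrier_vec m" "y \<in> carrier_vec n"
  shows "(M *\<^sub>v x) \<bullet> y = x \<bullet> (transpose_mat M *\<^sub>v y)"
  using transpose_vec_mult_scalar[of "M" n m x y] assms
  by (metis comm_scalar_prod mult_mat_vec_carrier transpose_carrier_mat)

lemma mat_mult_unit_vec:
  fixes M :: "'a :: semiring_1 mat"
  assumes "M \<in> carrier_mat n m" "j < m"
  shows "M *\<^sub>v unit_vec m j = col M j"
  using assms by (intro eq_vecI) auto

lemma smult_mat_mult_vec:
  fixes M :: "'a :: comm_semiring_0 mat"
  assumes "M \<in> carrier_mat n m" "x \<in> carrier_vec m"
  shows "(g \<cdot>\<^sub>m M) *\<^sub>v x = g \<cdot>\<^sub>v (M *\<^sub>v x)"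
  using assms by (intro eq_vecI) (auto simp: scalar_prod_def sum_distrib_left mult_ac)

lemma bilin_orth_form:
  assumes "x \<in> carrier_vec l" "y \<in> carrier_vec l"
  shows "bilin (orth_form l g) x y = g * ((orth_coords l *\<^sub>v x) \<bullet> (orth_coords l *\<^sub>v y))"
  using assms
  by (simp add: bilin_def orth_form_def scalar_prod_mult_mat_vec[of _ l l]
      assoc_mult_mat_vec[of _ l l _ l] mult_carrier_mat[of _ l l]
      mult_mat_vec_carrier[of _ l l] smult_mat_mult_vec[of _ l l])


lemma orth_form_symmetric: "transpose_mat (orth_form l g) = orth_form l g"
  by (intro eq_matI) (auto simp: orth_form_def scalar_prod_def mult_ac)

text \<open>Each sign occurs squared, and the permutation only reorders the summands.\<close>

lemma signed_perm_mats_scalar_prod: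
  assumes "M \<in> signed_perm_mats l" "u \<in> carrier_vec l" "v \<in> carrier_vec l"
  shows "(M *\<^sub>v u) \<bullet> (M *\<^sub>v v) = u \<bullet> v"
proof -
  obtain p \<epsilon> where M: "M = signed_perm_mat l p \<epsilon>" and p: "p permutes {0..<l}"
      and \<epsilon>: "\<forall>i<l. \<epsilon> i \<in> {1, - 1}"
    using assms(1) by (auto simp: signed_perm_mats_def)
  have "(M *\<^sub>v u) \<bullet> (M *\<^sub>v v) = (\<Sum>i = 0..<l. (\<epsilon> i * u $ p i) * (\<epsilon> i * v $ p i))"
    unfolding M scalar_prod_def using p assms(2,3)
    by (intro sum.cong) (simp_all add: signed_perm_mat_mult_vec del: index_mult_mat_vec)
  also have "\<dots> = (\<Sum>i = 0..<l. u $ p i * v $ p i)"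
    using \<epsilon> by (intro sum.cong) auto
  also have "\<dots> = u \<bullet> v"
    using sum.permute[OF p, of "\<lambda>i. u $ i * v $ i"] assms by (simp add: scalar_prod_def comp_def)
  finally show ?thesis .
qed

lemma orth_form_invariant:
  assumes "w \<in> C_weyl_group l" "x \<in> carrier_vec l" "y \<in> carrier_vec l"
  shows "bilin (orth_form l g) (w *\<^sub>v x) (w *\<^sub>v y) = bilin (orth_form l g) x y"
proof -
  obtain M where M: "M \<in> signed_perm_mats l" "w = from_orth l M"
    using assms(1) C_weyl_group_eq by auto
  then show ?thesis
    using assms signed_perm_mats_carrier[OF M(1)] weyl_group_carrier[OF assms(1)]
    by (simp add: bilin_orth_form mult_mat_vec_carrier[of _ l l] from_orth_mult_vec
        signed_perm_mats_scalar_prod)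
qed

text \<open>Each root is a Weyl group image of a simple root, so an invariant form takes all its
  root norms on the simple roots. The form \<open>G\<close> is arbitrary because uniqueness of the
  normalized form relies on this too.\<close>

lemma root_norms_image:
  assumes "\<forall>w\<in>C_weyl_group l. \<forall>x\<in>carrier_vec l. \<forall>y\<in>carrier_vec l.
     bilin G (w *\<^sub>v x) (w *\<^sub>v y) = bilin G x y"
  shows "(\<lambda>\<alpha>. bilin G \<alpha> \<alpha>) ` roots (cartan_C_affine l) l =
     (\<lambda>i. bilin G (C_simple_root l i) (C_simple_root l i)) ` {1..l}" (is "?L = ?R")
proof -
  have root: "C_simple_root l i \<in> carrier_vec l" for i
    by (simp add: simple_root_def)
  show ?thesis
  proof (intro equalityI subsetI)
    fix y assume "y \<in> ?L"
    with assms root show "y \<in> ?R"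
      by (auto simp: roots_def)
  next
    fix y assume "y \<in> ?R"
    then obtain i where i: "i \<in> {1..l}" "y = bilin G (C_simple_root l i) (C_simple_root l i)"
      by auto
    have "1\<^sub>m l *\<^sub>v C_simple_root l i \<in> roots (cartan_C_affine l) l"
      using i weyl_group.one unfolding roots_def by blast
    then show "y \<in> ?L"
      using i root by auto
  qed
qed

lemma orth_root_norm:
  assumes "i \<in> {1..l}"
  shows "orth_root l i \<bullet> orth_root l i = (if i < l then 2 else 4)"
proof (cases "i < l")
  case True
  have "orth_root l i \<bullet> orth_root l i =
      (\<Sum>r = 0..<l. (if r = i - 1 then 1 else 0) + (if r = i then 1 else 0))"
    unfolding scalar_prod_def using True assms by (intro sum.cong) (auto simp: orth_root_def)
  with True assms show ?thesis
    by (auto simp: sum.distrib)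
next
  case False
  then have "orth_root l i \<bullet> orth_root l i = (\<Sum>r = 0..<l. if r = l - 1 then 4 else 0)"
    unfolding scalar_prod_def using assms by (intro sum.cong) (auto simp: orth_root_def)
  with False assms show ?thesis
    by auto
qed

lemma orth_form_root_norm:
  "i \<in> {1..l} \<Longrightarrow> bilin (orth_form l g) (C_simple_root l i) (C_simple_root l i) =
     g * (if i < l then 2 else 4)"
  by (simp add: bilin_orth_form orth_root_norm mult_mat_vec_carrier[of _ l l]
      flip: fund_coords_orth_root)

text \<open>Attaining the value \<open>2\<close> leaves \<open>g = 1\<close> and
  \<open>g = 1/2\<close>, and the bound by the long root norm \<open>4 g\<close> excludes the first.
  For \<open>l = 1\<close> only the long norm occurs.\<close>

lemma Max_root_norms_iff:
  fixes l :: nat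
  assumes "l \<ge> 1"
  shows "Max ((\<lambda>i. g * (if i < l then 2 else 4)) ` {1..l}) = 2 \<longleftrightarrow> g = (1/2 :: real)"
proof
  let ?N = "(\<lambda>i. g * (if i < l then 2 else 4)) ` {1..l}"
  assume max: "Max ?N = 2"
  have "Max ?N \<in> ?N"
    using assms by (intro Max_in) auto
  then have "2 \<in> ?N"
    by (simp only: max)
  then have "g = 1 \<or> g = 1/2"
    by (auto split: if_splits)
  moreover have "g * 4 \<le> Max ?N"
    using assms by (intro Max_ge) auto
  then have "g * 4 \<le> 2"
    by (simp only: max)
  ultimately show "g = 1/2"
    by auto
next
  assume "g = 1/2"
  then show "Max ((\<lambda>i. g * (if i < l then 2 else 4)) ` {1..l}) = 2"
    using assms by (intro Max_eqI) auto
qed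

lemma from_orth_mult_fund_vec:
  assumes "M \<in> carrier_mat l l" "v \<in> carrier_vec l"
  shows "from_orth l M *\<^sub>v (fund_coords l *\<^sub>v v) = fund_coords l *\<^sub>v (M *\<^sub>v v)"
proof -
  have "from_orth l M *\<^sub>v (fund_coords l *\<^sub>v v) =
      fund_coords l *\<^sub>v (orth_coords l *\<^sub>v (from_orth l M *\<^sub>v (fund_coords l *\<^sub>v v)))"
    using assms by (simp add: mult_mat_vec_carrier[of _ l l])
  also have "\<dots> = fund_coords l *\<^sub>v (M *\<^sub>v v)"
    using assms by (simp add: from_orth_mult_vec mult_mat_vec_carrier[of _ l l])
  finally show ?thesis .
qed

text \<open>
  In orthogonal coordinates, invariance under sign changes kills the off-diagonal entries of the
  Gram matrix, and invariance under transpositions makes its diagonal constant.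
\<close>

lemma invariant_form_eq_orth_form:
  assumes l: "l \<ge> 1" and G: "G \<in> carrier_mat l l"
    and inv: "\<forall>w\<in>C_weyl_group l. \<forall>x\<in>carrier_vec l. \<forall>y\<in>carrier_vec l.
      bilin G (w *\<^sub>v x) (w *\<^sub>v y) = bilin G x y"
  shows "\<exists>g. G = orth_form l g"
proof -
  let ?F = "fund_coords l" and ?B = "orth_coords l"
  \<comment> \<open>\<open>H\<close> is the Gram matrix of \<open>G\<close> in orthogonal
    coordinates, where the Weyl group acts by signed permutations.\<close>
  define H where "H = transpose_mat ?F * (G * ?F)"
  have H: "H \<in> carrier_mat l l"
    using G by (simp add: H_def mult_carrier_mat[of _ l l])
  have bilin_H: "u \<bullet> (H *\<^sub>v v) = bilin G (?F *\<^sub>v u) (?F *\<^sub>v v)"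
    if "u \<in> carrier_vec l" "v \<in> carrier_vec l" for u v
    using that G
    by (simp add: H_def bilin_def scalar_prod_mult_mat_vec[of _ l l] mult_mat_vec_carrier[of _ l l]
        assoc_mult_mat_vec[of _ l l _ l] mult_carrier_mat[of _ l l])
  have H_inv: "(M *\<^sub>v u) \<bullet> (H *\<^sub>v (M *\<^sub>v v)) = u \<bullet> (H *\<^sub>v v)"
    if M: "M \<in> signed_perm_mats l" and uv: "u \<in> carrier_vec l" "v \<in> carrier_vec l" for M u v
  proof -
    have "from_orth l M \<in> C_weyl_group l" "M \<in> carrier_mat l l"
      using M by (auto simp: C_weyl_group_eq signed_perm_mats_carrier)
    then show ?thesis
      using uv inv[rule_format, of "from_orth l M" "?F *\<^sub>v u" "?F *\<^sub>v v"]
      by (simp add: bilin_H mult_mat_vec_carrier[of _ l l] from_orth_mult_fund_vec)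
  qed
  have entry: "H $$ (a, b) = unit_vec l a \<bullet> (H *\<^sub>v unit_vec l b)" if "a < l" "b < l" for a b
    using that H by (simp add: mat_mult_unit_vec[of _ l l] mult_mat_vec_carrier[of _ l l])
  have off_diag: "H $$ (a, b) = 0" if ab: "a < l" "b < l" "a \<noteq> b" for a b
  proof -
    let ?M = "signed_perm_mat l id (\<lambda>i. if i = a then - 1 else 1)"
    have "?M *\<^sub>v unit_vec l a = - unit_vec l a" "?M *\<^sub>v unit_vec l b = unit_vec l b"
      using ab by (auto intro!: eq_vecI simp: signed_perm_mat_mult_vec[OF permutes_id]
          simp del: index_mult_mat_vec)
    moreover have "?M \<in> signed_perm_mats l"
      by (intro signed_perm_mat_in_mats permutes_id) auto
    ultimately have "- unit_vec l a \<bullet> (H *\<^sub>v unit_vec l b) = unit_vec l a \<bullet> (H *\<^sub>v unit_vec l b)"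
      using H_inv[of ?M "unit_vec l a" "unit_vec l b"] by simp
    moreover have "H *\<^sub>v unit_vec l b \<in> carrier_vec l"
      using H by (simp add: mult_mat_vec_carrier[of _ l l])
    ultimately have "- (unit_vec l a \<bullet> (H *\<^sub>v unit_vec l b)) = unit_vec l a \<bullet> (H *\<^sub>v unit_vec l b)"
      by (metis carrier_vecD index_unit_vec(3) uminus_scalar_prod unit_vec_carrier)
    then show ?thesis
      unfolding entry[OF ab(1,2)] by linarith
  qed
  have diag: "H $$ (a, a) = H $$ (0, 0)" if a: "a < l" for a
  proof -
    let ?M = "signed_perm_mat l (transpose 0 a) (\<lambda>_. 1)"
    have p: "transpose 0 a permutes {0..<l}"
      using a by (intro permutes_swap_id) auto
    have "?M *\<^sub>v unit_vec l a = unit_vec l 0"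
      using a p by (auto intro!: eq_vecI simp: signed_perm_mat_mult_vec permutes_lt transpose_def
          simp del: index_mult_mat_vec)
    moreover have "?M \<in> signed_perm_mats l"
      using p by (intro signed_perm_mat_in_mats) auto
    ultimately have "unit_vec l 0 \<bullet> (H *\<^sub>v unit_vec l 0) = unit_vec l a \<bullet> (H *\<^sub>v unit_vec l a)"
      using H_inv[of ?M "unit_vec l a" "unit_vec l a"] by simp
    moreover have "0 < l"
      using l by simp
    ultimately show ?thesis
      using a by (simp only: entry)
  qed
  have "H = H $$ (0, 0) \<cdot>\<^sub>m 1\<^sub>m l"
    using H off_diag by (intro eq_matI) (auto simp: diag[symmetric])
  \<comment> \<open>Undoing the change of basis expresses \<open>G\<close> through the scalar matrix
    \<open>H\<close>.\<close>
  moreover have "G = transpose_mat ?B * (H * ?B)"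
  proof -
    have "transpose_mat ?B * transpose_mat ?F = 1\<^sub>m l"
      by (simp flip: transpose_mult[of _ l l _ l])
    moreover have "H * ?B = transpose_mat ?F * G"
      using G by (simp add: H_def assoc_mult_mat[of _ l l _ l _ l] mult_carrier_mat[of _ l l])
    ultimately show ?thesis
      using G by (simp flip: assoc_mult_mat[of _ l l _ l _ l])
  qed
  ultimately have "G = transpose_mat ?B * (H $$ (0, 0) \<cdot>\<^sub>m 1\<^sub>m l * ?B)"
    by metis
  also have "\<dots> = orth_form l (H $$ (0, 0))"
    by (simp add: orth_form_def mult_smult_assoc_mat[of _ l l _ l] mult_smult_distrib[of _ l l _ l])
  finally show ?thesis ..
qed

text \<open>Uniqueness holds because every invariant form is a multiple of the standard one and the
  normalization of the root norms fixes the factor.\<close>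

lemma normalized_form_C:
  assumes l: "l \<ge> 1"
  shows "normalized_form (cartan_C_affine l) l = orth_form l (1/2)"
  unfolding normalized_form_def
proof (rule the_equality, intro conjI ballI)
  have "(\<lambda>i. bilin (orth_form l (1/2)) (C_simple_root l i) (C_simple_root l i)) ` {1..l} =
      (\<lambda>i. (1/2) * (if i < l then 2 else 4)) ` {1..l}"
    by (intro image_cong orth_form_root_norm refl)
  then show "Max ((\<lambda>\<alpha>. bilin (orth_form l (1/2)) \<alpha> \<alpha>) ` roots (cartan_C_affine l) l) = 2"
    using Max_root_norms_iff[OF l, of "1/2"] by (simp add: root_norms_image orth_form_invariant)
next
  fix G
  assume G: "G \<in> carrier_mat l l \<and> transpose_mat G = G \<and>
    (\<forall>w\<in>C_weyl_group l. \<forall>x\<in>carrier_vec l. \<forall>y\<in>carrier_vec l.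
       bilin G (w *\<^sub>v x) (w *\<^sub>v y) = bilin G x y) \<and>
    Max ((\<lambda>\<alpha>. bilin G \<alpha> \<alpha>) ` roots (cartan_C_affine l) l) = 2"
  then have "Max ((\<lambda>i. bilin G (C_simple_root l i) (C_simple_root l i)) ` {1..l}) = 2"
    using root_norms_image[of l G] by simp
  moreover obtain g where g: "G = orth_form l g"
    using G invariant_form_eq_orth_form[OF l] by blast
  moreover have "(\<lambda>i. bilin G (C_simple_root l i) (C_simple_root l i)) ` {1..l} =
      (\<lambda>i. g * (if i < l then 2 else 4)) ` {1..l}"
    unfolding g by (intro image_cong orth_form_root_norm refl)
  ultimately have "g = 1/2"
    using Max_root_norms_iff[OF l, of g] by simp
  with g show "G = orth_form l (1/2)"
    by simp
qed (auto simp: orth_form_symmetric orth_form_invariant)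

subsection \<open>Kac-Peterson matrices of type C as determinants\<close>

text \<open>This equals \<open>- 2 i sin (pi a b / n)\<close>; the difference of exponentials is
  what the two signs of one coordinate contribute.\<close>

definition kp_kernel :: "nat \<Rightarrow> real \<Rightarrow> real \<Rightarrow> complex" where
  "kp_kernel n a b = exp (- (of_real (pi * a * b / n) * \<i>)) - exp (of_real (pi * a * b / n) * \<i>)"

text \<open>Both stages of the parametrization of the Weyl group are injective, so the sum can be
  reindexed by pairs of a permutation and a sign vector.\<close>

lemma sum_C_weyl_group:
  fixes f :: "real mat \<Rightarrow> complex"
  shows "(\<Sum>w\<in>C_weyl_group l. f w) =
    (\<Sum>p | p permutes {0..<l}. \<Sum>\<epsilon>\<in>{0..<l} \<rightarrow>\<^sub>E {1, - 1}. f (from_orth l (signed_perm_mat l p \<epsilon>)))"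
proof -
  have inj1: "inj_on (from_orth l) (signed_perm_mats l)"
    by (metis (no_types) inj_onI from_orth_inject signed_perm_mats_carrier)
  have inj2: "inj_on (\<lambda>(p, \<epsilon>). signed_perm_mat l p \<epsilon>)
      ({p. p permutes {0..<l}} \<times> ({0..<l} \<rightarrow>\<^sub>E {1, - 1}))"
  proof (intro inj_onI)
    fix x y assume *: "x \<in> {p. p permutes {0..<l}} \<times> ({0..<l} \<rightarrow>\<^sub>E {1, - 1})"
      "y \<in> {p. p permutes {0..<l}} \<times> ({0..<l} \<rightarrow>\<^sub>E {1, - 1})"
      "(\<lambda>(p, \<epsilon>). signed_perm_mat l p \<epsilon>) x = (\<lambda>(p, \<epsilon>). signed_perm_mat l p \<epsilon>) y"
    obtain p \<epsilon> q \<eta> where xy: "x = (p, \<epsilon>)" "y = (q, \<eta>)"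
      by fastforce
    have "p permutes {0..<l}" "q permutes {0..<l}" "\<epsilon> \<in> {0..<l} \<rightarrow>\<^sub>E {1, - 1}"
        "\<eta> \<in> {0..<l} \<rightarrow>\<^sub>E {1, - 1}" "signed_perm_mat l p \<epsilon> = signed_perm_mat l q \<eta>"
      using * unfolding xy by simp_all
    from signed_perm_mat_inject[OF this] show "x = y"
      by (simp add: xy)
  qed
  show ?thesis
    unfolding C_weyl_group_eq signed_perm_mats_eq_image sum.cartesian_product
      sum.reindex[OF inj1, unfolded signed_perm_mats_eq_image] sum.reindex[OF inj2]
    by (auto intro!: sum.cong)
qed

text \<open>Summing over the signs first turns each row factor into a value of the kernel.\<close>

lemma C_weyl_sum_eq_det:
  assumes x: "x \<in> carrier_vec l" and y: "y \<in> carrier_vec l"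
  shows "(\<Sum>w\<in>C_weyl_group l. of_real (det w) *
      exp (- (2 * of_real pi * \<i> * of_real (bilin (orth_form l (1/2)) x (w *\<^sub>v y)) / of_nat n))) =
    det (mat l l (\<lambda>(i, j). kp_kernel n ((orth_coords l *\<^sub>v x) $ i) ((orth_coords l *\<^sub>v y) $ j)))"
proof -
  define u v where "u = orth_coords l *\<^sub>v x" and "v = orth_coords l *\<^sub>v y"
  have uv: "u \<in> carrier_vec l" "v \<in> carrier_vec l"
    using x y by (auto simp: u_def v_def mult_mat_vec_carrier[of _ l l])
  define e where "e a b = exp (- (of_real (pi * a * b / n) * \<i>))" for a b :: real
  have "of_real (det (from_orth l (signed_perm_mat l p \<epsilon>))) *
      exp (- (2 * of_real pi * \<i> *
        of_real (bilin (orth_form l (1/2)) x (from_orth l (signed_perm_mat l p \<epsilon>) *\<^sub>v y)) / of_nat n)) =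
      signof p * (\<Prod>i\<in>{0..<l}. of_real (\<epsilon> i) * e (u $ i) (\<epsilon> i * v $ p i))"
    if p: "p permutes {0..<l}" for p \<epsilon>
  proof -
    have "bilin (orth_form l (1/2)) x (from_orth l (signed_perm_mat l p \<epsilon>) *\<^sub>v y) =
        1/2 * (u \<bullet> (signed_perm_mat l p \<epsilon> *\<^sub>v v))"
      using x y by (simp add: bilin_orth_form u_def v_def from_orth_mult_vec mult_mat_vec_carrier[of _ l l])
    also have "u \<bullet> (signed_perm_mat l p \<epsilon> *\<^sub>v v) = (\<Sum>i\<in>{0..<l}. u $ i * (\<epsilon> i * v $ p i))"
      unfolding scalar_prod_def using uv p
      by (intro sum.cong) (simp_all add: signed_perm_mat_mult_vec del: index_mult_mat_vec)
    \<comment> \<open>The factor \<open>1/2\<close> of the normalized form cancels the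
      \<open>2\<close> of \<open>2 pi i\<close>, and the exponent becomes a sum with one term per
      coordinate.\<close>
    finally have "- (2 * of_real pi * \<i> *
        of_real (bilin (orth_form l (1/2)) x (from_orth l (signed_perm_mat l p \<epsilon>) *\<^sub>v y)) / of_nat n) =
        (\<Sum>i\<in>{0..<l}. - (of_real (pi * u $ i * (\<epsilon> i * v $ p i) / n) * \<i>))"
      by (simp add: sum_distrib_left sum_distrib_right sum_divide_distrib sum_negf mult_ac)
    then show ?thesis
      using p by (simp add: det_from_orth det_signed_perm_mat exp_sum e_def prod.distrib
          lessThan_atLeast0 sign_def)
  qed
  then have "(\<Sum>w\<in>C_weyl_group l. of_real (det w) *
      exp (- (2 * of_real pi * \<i> * of_real (bilin (orth_form l (1/2)) x (w *\<^sub>v y)) / of_nat n))) =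
    (\<Sum>p | p permutes {0..<l}. \<Sum>\<epsilon>\<in>{0..<l} \<rightarrow>\<^sub>E {1, - 1}.
       signof p * (\<Prod>i\<in>{0..<l}. of_real (\<epsilon> i) * e (u $ i) (\<epsilon> i * v $ p i)))"
    unfolding sum_C_weyl_group by (intro sum.cong refl) auto
  also have "\<dots> = (\<Sum>p | p permutes {0..<l}. signof p *
      (\<Prod>i\<in>{0..<l}. \<Sum>s\<in>{1, - 1}. of_real s * e (u $ i) (s * v $ p i)))"
    by (intro sum.cong refl, subst prod_sum_PiE) (auto simp: sum_distrib_left)
  also have "\<dots> = (\<Sum>p | p permutes {0..<l}. signof p *
      (\<Prod>i\<in>{0..<l}. kp_kernel n (u $ i) (v $ p i)))"
    by (simp add: e_def kp_kernel_def)
  also have "\<dots> = det (mat l l (\<lambda>(i, j). kp_kernel n (u $ i) (v $ j)))"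
    by (subst det_def'[of _ l]) (auto intro!: sum.cong prod.cong simp: permutes_lt)
  finally show ?thesis
    by (simp add: u_def v_def)
qed

text \<open>The coefficient of \<open>\<epsilon>_(i+1)\<close> in the finite part of \<open>\<Lambda>\<close> shifted by \<open>\<rho>\<close>.\<close>

definition shifted_coord :: "nat \<Rightarrow> (nat \<Rightarrow> nat) \<Rightarrow> nat \<Rightarrow> nat" where
  "shifted_coord l \<Lambda> i = (\<Sum>j = Suc i..l. Suc (\<Lambda> j))"

lemma orth_coords_shifted_weight:
  assumes "i < l"
  shows "(orth_coords l *\<^sub>v (finite_part l \<Lambda> + rho l)) $ i = real (shifted_coord l \<Lambda> i)"
proof -
  have "(orth_coords l *\<^sub>v (finite_part l \<Lambda> + rho l)) $ i =
      (\<Sum>j = 0..<l. if i \<le> j then real (Suc (\<Lambda> (Suc j))) else 0)"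
    using assms
    by (auto simp: orth_coords_def finite_part_def rho_def scalar_prod_def intro!: sum.cong)
  also have "\<dots> = (\<Sum>j = i..<l. real (Suc (\<Lambda> (Suc j))))"
    by (intro sum.mono_neutral_cong_right) auto
  also have "\<dots> = real (\<Sum>j = Suc i..<Suc l. Suc (\<Lambda> j))"
    unfolding sum.shift_bounds_Suc_ivl by simp
  finally show ?thesis
    by (simp add: shifted_coord_def atLeastLessThanSuc_atLeastAtMost)
qed

text \<open>Stated from rank one on, so that it also serves the A1 matrix. The first kernel argument
  \<open>k + Suc l\<close> is level plus dual Coxeter number.\<close>

lemma kac_peterson_C_eq_det:
  assumes l: "l \<ge> 1" and S: "kac_peterson_matrix (cartan_C_affine l) l k S"
  obtains c where "c \<noteq> 0"
    and "\<And>\<Lambda> \<Lambda>'. \<Lambda> \<in> dominant_weights (cartan_C_affine l) l k \<Longrightarrow>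
      \<Lambda>' \<in> dominant_weights (cartan_C_affine l) l k \<Longrightarrow>
      S \<Lambda> \<Lambda>' = c * det (mat l l (\<lambda>(i, j).
        kp_kernel (k + Suc l) (shifted_coord l \<Lambda> i) (shifted_coord l \<Lambda>' j)))"
proof -
  obtain c where c: "c \<noteq> 0" and eq: "\<And>\<Lambda> \<Lambda>'. \<Lambda> \<in> dominant_weights (cartan_C_affine l) l k \<Longrightarrow>
      \<Lambda>' \<in> dominant_weights (cartan_C_affine l) l k \<Longrightarrow>
      S \<Lambda> \<Lambda>' = c * (\<Sum>w\<in>C_weyl_group l. of_real (det w) *
        exp (- (2 * of_real pi * \<i> *
          of_real (bilin (orth_form l (1/2))
            (finite_part l \<Lambda> + rho l) (w *\<^sub>v (finite_part l \<Lambda>' + rho l))) /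
          of_nat (k + Suc l))))"
    using S l unfolding kac_peterson_matrix_def
    by (auto simp: normalized_form_C dual_coxeter_number_C)
  show ?thesis
  proof (rule that[OF c])
    fix \<Lambda> \<Lambda>' assume *: "\<Lambda> \<in> dominant_weights (cartan_C_affine l) l k"
      "\<Lambda>' \<in> dominant_weights (cartan_C_affine l) l k"
    have vec: "finite_part l M + rho l \<in> carrier_vec l" for M
      by (simp add: finite_part_def rho_def)
    have "mat l l (\<lambda>(i, j). kp_kernel (k + Suc l)
          ((orth_coords l *\<^sub>v (finite_part l \<Lambda> + rho l)) $ i)
          ((orth_coords l *\<^sub>v (finite_part l \<Lambda>' + rho l)) $ j)) =
        mat l l (\<lambda>(i, j).
          kp_kernel (k + Suc l) (shifted_coord l \<Lambda> i) (shifted_coord l \<Lambda>' j))"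
      by (intro eq_matI) (simp_all add: orth_coords_shifted_weight del: index_mult_mat_vec)
    then show "S \<Lambda> \<Lambda>' = c * det (mat l l (\<lambda>(i, j).
        kp_kernel (k + Suc l) (shifted_coord l \<Lambda> i) (shifted_coord l \<Lambda>' j)))"
      unfolding eq[OF *] C_weyl_sum_eq_det[OF vec vec] by simp
  qed
qed

subsection \<open>The affine algebra of type A1 as the rank one case of type C\<close>

text \<open>\<open>cartan_A1_affine\<close> and \<open>cartan_C_affine 1\<close> differ as functions
  beyond index \<open>1\<close>. The notions below consult only indices up to \<open>l\<close>, so
  agreement there suffices to transfer them.\<close>

context
  fixes A A' :: "nat \<Rightarrow> nat \<Rightarrow> int" and l :: nat
  assumes agree: "\<And>i j. i \<le> l \<Longrightarrow> j \<le> l \<Longrightarrow> A i j = A' i j"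
begin

lemma dual_kac_labels_cong: "dual_kac_labels A l = dual_kac_labels A' l"
  unfolding dual_kac_labels_def by (simp add: agree)

lemma simple_root_cong: "i \<le> l \<Longrightarrow> simple_root A l i = simple_root A' l i"
  unfolding simple_root_def by (intro eq_vecI) (simp_all add: agree)

lemma simple_reflection_cong: "i \<le> l \<Longrightarrow> simple_reflection A l i = simple_reflection A' l i"
  unfolding simple_reflection_def by (subst simple_root_cong) simp_all

lemma weyl_group_cong: "weyl_group A l = weyl_group A' l"
proof (intro equalityI subsetI)
  fix w assume "w \<in> weyl_group A l"
  then show "w \<in> weyl_group A' l"
    by induction (auto simp: simple_reflection_cong intro: weyl_group.intros)
next
  fix w assume "w \<in> weyl_group A' l"
  then show "w \<in> weyl_group A l"
    by induction (auto simp: simple_reflection_cong[symmetric] intro: weyl_group.intros)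
qed

lemma roots_cong: "roots A l = roots A' l"
  unfolding roots_def weyl_group_cong using simple_root_cong by force

lemma dominant_weights_cong: "dominant_weights A l = dominant_weights A' l"
  unfolding dominant_weights_def by (simp add: dual_kac_labels_cong)

lemma kac_peterson_matrix_cong: "kac_peterson_matrix A l = kac_peterson_matrix A' l"
  unfolding kac_peterson_matrix_def normalized_form_def dual_coxeter_number_def
  by (simp only: dominant_weights_cong weyl_group_cong roots_cong dual_kac_labels_cong)

end

lemma cartan_A1_affine_eq: "i \<le> 1 \<Longrightarrow> j \<le> 1 \<Longrightarrow> cartan_A1_affine i j = cartan_C_affine 1 i j"
  by (cases i; cases j) (auto simp: cartan_A1_affine_def cartan_C_affine_def)

lemmas dominant_weights_A1 = dominant_weights_cong[OF cartan_A1_affine_eq]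
lemmas kac_peterson_matrix_A1 = kac_peterson_matrix_cong[OF cartan_A1_affine_eq]

text \<open>In rank one the determinant has a single entry, and the only shifted coordinate is the
  label of node \<open>1\<close> plus one.\<close>

lemma kac_peterson_A1_eq:
  assumes "kac_peterson_matrix cartan_A1_affine 1 k S"
  obtains c where "c \<noteq> 0"
    and "\<And>\<Lambda> \<Lambda>'. \<Lambda> \<in> dominant_weights cartan_A1_affine 1 k \<Longrightarrow>
      \<Lambda>' \<in> dominant_weights cartan_A1_affine 1 k \<Longrightarrow>
      S \<Lambda> \<Lambda>' = c * kp_kernel (k + 2) (Suc (\<Lambda> 1)) (Suc (\<Lambda>' 1))"
proof -
  have "kac_peterson_matrix (cartan_C_affine 1) 1 k S"
    using assms by (simp only: kac_peterson_matrix_A1)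
  then obtain c where c: "c \<noteq> 0"
    and *: "\<And>\<Lambda> \<Lambda>'. \<Lambda> \<in> dominant_weights (cartan_C_affine 1) 1 k \<Longrightarrow>
      \<Lambda>' \<in> dominant_weights (cartan_C_affine 1) 1 k \<Longrightarrow>
      S \<Lambda> \<Lambda>' = c * det (mat 1 1 (\<lambda>(i, j).
        kp_kernel (k + Suc 1) (shifted_coord 1 \<Lambda> i) (shifted_coord 1 \<Lambda>' j)))"
    using kac_peterson_C_eq_det[of 1 k S] by blast
  have single: "det (mat 1 1 f) = f (0, 0)" for f :: "nat \<times> nat \<Rightarrow> complex"
    by (subst det_single) auto
  show ?thesis
  proof (rule that[OF c])
    fix \<Lambda> \<Lambda>' assume "\<Lambda> \<in> dominant_weights cartan_A1_affine 1 k"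
      "\<Lambda>' \<in> dominant_weights cartan_A1_affine 1 k"
    then have "\<Lambda> \<in> dominant_weights (cartan_C_affine 1) 1 k"
      "\<Lambda>' \<in> dominant_weights (cartan_C_affine 1) 1 k"
      by (simp_all only: dominant_weights_A1)
    from *[OF this] show "S \<Lambda> \<Lambda>' = c * kp_kernel (k + 2) (Suc (\<Lambda> 1)) (Suc (\<Lambda>' 1))"
      by (simp only: single) (simp add: shifted_coord_def)
  qed
qed

subsection \<open>The bijection between weights and subsets\<close>

lemma shifted_coord_Suc:
  "i < l \<Longrightarrow> shifted_coord l \<Lambda> i = shifted_coord l \<Lambda> (Suc i) + Suc (\<Lambda> (Suc i))"
  unfolding shifted_coord_def by (subst sum.atLeast_Suc_atMost) auto

lemma shifted_coord_top [simp]: "shifted_coord l \<Lambda> l = 0"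
  by (simp add: shifted_coord_def)

lemma shifted_coord_strict_antimono:
  assumes "i < j" "j \<le> l"
  shows "shifted_coord l \<Lambda> j < shifted_coord l \<Lambda> i"
proof -
  have "(\<Sum>j = Suc j..l. Suc (\<Lambda> j)) < (\<Sum>j = Suc i..l. Suc (\<Lambda> j))"
    using assms by (intro sum_strict_mono2[where b = "Suc i"]) auto
  then show ?thesis
    by (simp add: shifted_coord_def)
qed

text \<open>Both sides add up all labels and \<open>l\<close> ones. At fixed level this bounds the
  largest coordinate and recovers the label of node \<open>0\<close> from it.\<close>

lemma shifted_coord_0: "shifted_coord l \<Lambda> 0 + \<Lambda> 0 = (\<Sum>j\<le>l. \<Lambda> j) + l"
  unfolding shifted_coord_def atMost_atLeast0
  by (subst sum.atLeast_Suc_atMost[of 0 l]) (simp_all add: sum_Suc)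

definition shifted_coord_set :: "nat \<Rightarrow> (nat \<Rightarrow> nat) \<Rightarrow> nat set" where
  "shifted_coord_set l \<Lambda> = shifted_coord l \<Lambda> ` {..<l}"

text \<open>Coordinates decrease with the index, so listing them backwards gives the increasing
  enumeration of the set.\<close>

definition shifted_coord_list :: "nat \<Rightarrow> (nat \<Rightarrow> nat) \<Rightarrow> nat list" where
  "shifted_coord_list l \<Lambda> = map (\<lambda>\<nu>. shifted_coord l \<Lambda> (l - 1 - \<nu>)) [0..<l]"

lemma set_shifted_coord_list: "set (shifted_coord_list l \<Lambda>) = shifted_coord_set l \<Lambda>"
proof -
  have "(\<lambda>\<nu>. l - 1 - \<nu>) ` {0..<l} = {..<l}"
  proof (intro equalityI subsetI)
    fix i assume "i \<in> {..<l}"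
    then have "i = l - 1 - (l - 1 - i)" "l - 1 - i \<in> {0..<l}"
      by auto
    then show "i \<in> (\<lambda>\<nu>. l - 1 - \<nu>) ` {0..<l}"
      by blast
  qed auto
  then have "shifted_coord l \<Lambda> ` (\<lambda>\<nu>. l - 1 - \<nu>) ` {0..<l} = shifted_coord_set l \<Lambda>"
    by (simp only: shifted_coord_set_def)
  then show ?thesis
    by (simp only: shifted_coord_list_def image_image set_map set_upt)
qed

lemma length_shifted_coord_list [simp]: "length (shifted_coord_list l \<Lambda>) = l"
  by (simp add: shifted_coord_list_def)

lemma strict_sorted_shifted_coord_list: "sorted_wrt (<) (shifted_coord_list l \<Lambda>)"
  by (auto simp: shifted_coord_list_def sorted_wrt_iff_nth_less intro!: shifted_coord_strict_antimono)

lemma sorted_list_of_shifted_coord_set: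
  "sorted_list_of_set (shifted_coord_set l \<Lambda>) = shifted_coord_list l \<Lambda>"
  by (metis set_shifted_coord_list strict_sorted_shifted_coord_list
      sorted_list_of_set.idem_if_sorted_distinct strict_sorted_iff)

text \<open>A set determines its sorted list, hence the coordinates; their gaps give the labels of
  nodes \<open>1\<close> to \<open>l\<close>, and the level gives the remaining one. Conversely, the
  gaps of a set, lowered by one, serve as labels.\<close>

lemma bij_betw_shifted_coord_set:
  assumes l: "l \<ge> 1"
  shows "bij_betw (shifted_coord_set l) (dominant_weights (cartan_C_affine l) l k)
     {X. X \<subseteq> {1..k + l} \<and> card X = l}"
  unfolding dominant_weights_C[OF l]
proof (rule bij_betw_imageI)
  let ?D = "{\<Lambda>. (\<forall>j>l. \<Lambda> j = 0) \<and> (\<Sum>j\<le>l. \<Lambda> j) = k}"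
  show "inj_on (shifted_coord_set l) ?D"
  proof (intro inj_onI)
    fix \<Lambda> \<Lambda>' :: "nat \<Rightarrow> nat"
    assume \<Lambda>: "\<Lambda> \<in> ?D" "\<Lambda>' \<in> ?D" and eq: "shifted_coord_set l \<Lambda> = shifted_coord_set l \<Lambda>'"
    have coords: "shifted_coord l \<Lambda> i = shifted_coord l \<Lambda>' i" if "i \<le> l" for i
    proof (cases "i = l")
      case False
      have "shifted_coord_list l \<Lambda> ! (l - 1 - i) = shifted_coord_list l \<Lambda>' ! (l - 1 - i)"
        using eq by (metis sorted_list_of_shifted_coord_set)
      with that False show ?thesis
        by (simp add: shifted_coord_list_def)
    qed simp
    show "\<Lambda> = \<Lambda>'"
    proof
      fix j
      consider "j = 0" | i where "j = Suc i" "i < l" | "j > l"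
        by (metis Suc_leI leI not_less_eq not0_implies_Suc)
      then show "\<Lambda> j = \<Lambda>' j"
      proof cases
        case 1
        then show ?thesis
          using \<Lambda> coords[of 0] shifted_coord_0[of l \<Lambda>] shifted_coord_0[of l \<Lambda>'] by simp
      next
        case (2 i)
        then show ?thesis
          using coords[of i] coords[of "Suc i"] by (simp add: shifted_coord_Suc)
      next
        case 3
        with \<Lambda> show ?thesis
          by simp
      qed
    qed
  qed
  show "shifted_coord_set l ` ?D = {X. X \<subseteq> {1..k + l} \<and> card X = l}"
  proof (intro equalityI subsetI)
    fix X assume "X \<in> shifted_coord_set l ` ?D"
    then obtain \<Lambda> where \<Lambda>: "\<Lambda> \<in> ?D" "X = shifted_coord_set l \<Lambda>"
      by blast
    \<comment> \<open>Every coordinate exceeds the value \<open>0\<close> at index \<open>l\<close>,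
      and the greatest one is \<open>k + l\<close> minus the label of node \<open>0\<close>.\<close>
    have "shifted_coord l \<Lambda> i \<in> {1..k + l}" if "i < l" for i
      using \<Lambda>(1) that shifted_coord_0[of l \<Lambda>] shifted_coord_strict_antimono[of i l l \<Lambda>]
        shifted_coord_strict_antimono[of 0 i l \<Lambda>]
      by (cases "i = 0") auto
    moreover have "card X = l"
      using distinct_card[of "shifted_coord_list l \<Lambda>"] strict_sorted_shifted_coord_list[of l \<Lambda>] \<Lambda>(2)
      by (simp add: set_shifted_coord_list strict_sorted_iff)
    ultimately show "X \<in> {X. X \<subseteq> {1..k + l} \<and> card X = l}"
      by (auto simp: \<Lambda>(2) shifted_coord_set_def)
  next
    fix X assume "X \<in> {X. X \<subseteq> {1..k + l} \<and> card X = l}"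
    then have X: "X \<subseteq> {1..k + l}" "card X = l" "finite X"
      by (auto intro: finite_subset)
    define xs where "xs = sorted_list_of_set X"
    have xs: "length xs = l" "set xs = X" "sorted_wrt (<) xs"
      using X by (auto simp: xs_def)
    \<comment> \<open>The decreasing enumeration of \<open>X\<close>, continued by \<open>0\<close>
      at index \<open>l\<close> so that the last label is a gap as well.\<close>
    define x where "x i = (if i < l then xs ! (l - 1 - i) else 0)" for i
    have x_in: "x i \<in> {1..k + l}" if "i < l" for i
      using that xs(1,2) X(1) nth_mem[of "l - 1 - i" xs] by (auto simp: x_def)
    have x_less: "x (Suc i) < x i" if "i < l" for i
    proof (cases "Suc i < l")
      case True
      then show ?thesis
        using sorted_wrt_nth_less[OF xs(3), of "l - 1 - Suc i" "l - 1 - i"] xs(1)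
        by (simp add: x_def)
    next
      case False
      then show ?thesis
        using x_in[OF that] by (simp add: x_def)
    qed
    \<comment> \<open>Node \<open>0\<close> takes up what is left of the level. By
      \<open>x_in\<close> and \<open>x_less\<close> no subtraction is truncated.\<close>
    define \<Lambda> where
      "\<Lambda> j = (if j = 0 then k + l - x 0 else if j \<le> l then x (j - 1) - x j - 1 else 0)" for j
    have coords: "shifted_coord l \<Lambda> i = x i" if "i \<le> l" for i
      using that
    proof (induction rule: inc_induct)
      case base
      then show ?case
        by (simp add: x_def)
    next
      case (step i)
      then show ?case
        using x_less[of i] by (simp add: shifted_coord_Suc \<Lambda>_def)
    qed
    have "(\<Sum>j\<le>l. \<Lambda> j) = k"
      using shifted_coord_0[of l \<Lambda>] coords[of 0] x_in[of 0] l by (simp add: \<Lambda>_def)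
    then have "\<Lambda> \<in> ?D"
      by (simp add: \<Lambda>_def)
    moreover have "shifted_coord_list l \<Lambda> = xs"
      using xs(1) by (intro nth_equalityI) (simp_all add: shifted_coord_list_def coords x_def)
    then have "shifted_coord_set l \<Lambda> = X"
      using xs(2) set_shifted_coord_list[of l \<Lambda>] by simp
    ultimately show "X \<in> shifted_coord_set l ` ?D"
      by blast
  qed
qed

text \<open>The weight of type A1 and level \<open>n\<close> whose orthogonal coordinate shifted by \<open>\<rho>\<close> is \<open>m\<close>.\<close>

definition A1_weight :: "nat \<Rightarrow> nat \<Rightarrow> nat \<Rightarrow> nat" where
  "A1_weight n m j = (if j = 0 then Suc n - m else if j = 1 then m - 1 else 0)"

lemma bij_betw_A1_weight:
  "bij_betw (A1_weight n) {1..Suc n} (dominant_weights cartan_A1_affine 1 n)"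
proof -
  have D: "dominant_weights cartan_A1_affine 1 n = {\<Lambda>. (\<forall>j>1. \<Lambda> j = 0) \<and> (\<Sum>j\<le>1. \<Lambda> j) = n}"
    by (simp only: dominant_weights_A1 dominant_weights_C[OF order_refl])
  show ?thesis
    unfolding D
  proof (rule bij_betwI')
    fix m m' assume "m \<in> {1..Suc n}" "m' \<in> {1..Suc n}"
    then have "m = m'" if "A1_weight n m = A1_weight n m'"
      using fun_cong[OF that, of 1] by (auto simp: A1_weight_def)
    then show "(A1_weight n m = A1_weight n m') = (m = m')"
      by blast
  next
    fix m assume "m \<in> {1..Suc n}"
    then show "A1_weight n m \<in> {\<Lambda>. (\<forall>j>1. \<Lambda> j = 0) \<and> (\<Sum>j\<le>1. \<Lambda> j) = n}"
      by (auto simp: A1_weight_def)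
  next
    fix \<Lambda> :: "nat \<Rightarrow> nat" assume "\<Lambda> \<in> {\<Lambda>. (\<forall>j>1. \<Lambda> j = 0) \<and> (\<Sum>j\<le>1. \<Lambda> j) = n}"
    then have "\<Lambda> = A1_weight n (Suc (\<Lambda> 1))" "Suc (\<Lambda> 1) \<in> {1..Suc n}"
      by (auto simp: A1_weight_def fun_eq_iff)
    then show "\<exists>m\<in>{1..Suc n}. \<Lambda> = A1_weight n m"
      by blast
  qed
qed

section \<open>Sets of A1 weights, their ordered enumeration, and reversal of determinants\<close>

lemma bij_betw_image_subsets_card:
  assumes f: "bij_betw f A B"
  shows "bij_betw ((`) f) {X. X \<subseteq> A \<and> card X = m} {Y. Y \<subseteq> B \<and> card Y = m}"
proof (rule bij_betw_subset[OF bij_betw_Pow[OF f]])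
  have card: "card (f ` X) = card X" if "X \<subseteq> A" for X
    using that bij_betw_imp_inj_on[OF f] by (metis card_image inj_on_subset)
  show "(`) f ` {X. X \<subseteq> A \<and> card X = m} = {Y. Y \<subseteq> B \<and> card Y = m}"
  proof (intro equalityI subsetI)
    fix Y assume "Y \<in> {Y. Y \<subseteq> B \<and> card Y = m}"
    moreover from this obtain X where "X \<subseteq> A" "Y = f ` X"
      using bij_betw_imp_surj_on[OF f] by (metis (mono_tags) mem_Collect_eq subset_imageE)
    ultimately show "Y \<in> (`) f ` {X. X \<subseteq> A \<and> card X = m}"
      using card by auto
  qed (use card bij_betw_imp_surj_on[OF f] in auto)
qed auto

text \<open>Strictly increasing keys make \<open>f\<close> injective on \<open>set xs\<close>, which
  allows the locale behind \<open>sorted_key_list_of_set\<close> to be interpreted there.\<close>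

lemma (in linorder) sorted_key_list_of_set_eqI:
  assumes "sorted_wrt (<) (map f xs)"
  shows "sorted_key_list_of_set f (set xs) = xs"
proof -
  have "sorted (map f xs)" "distinct (map f xs)"
    using assms by (simp_all add: strict_sorted_iff)
  moreover from this have "inj_on f (set xs)"
    by (simp add: distinct_map)
  then interpret folding_insort_key "(\<le>)" "(<)" "set xs" f
    by unfold_locales
  from calculation show ?thesis
    by (intro idem_if_sorted_distinct) (auto simp: distinct_map)
qed

text \<open>On \<open>{1..Suc n}\<close> the key \<open>m - 1\<close> of the weight increases
  strictly with \<open>m\<close>, so the order of the weights is the order of the numbers.\<close>

lemma sorted_key_list_of_set_A1_weights:
  assumes "X \<subseteq> {1..Suc n}"
  shows "sorted_key_list_of_set (\<lambda>M. M 1) (A1_weight n ` X) =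
    map (A1_weight n) (sorted_list_of_set X)"
proof -
  have [simp]: "finite X"
    using assms finite_subset by blast
  have "sorted_wrt (<) (map (\<lambda>M. M 1) (map (A1_weight n) (sorted_list_of_set X)))"
    unfolding sorted_wrt_map
  proof (rule sorted_wrt_mono_rel[of _ "(<)"])
    fix a b assume "a \<in> set (sorted_list_of_set X)" "a < b"
    \<comment> \<open>Positivity matters here: the truncated \<open>m - 1\<close> does not separate
      \<open>0\<close> from \<open>1\<close>.\<close>
    moreover from this have "1 \<le> a"
      using assms by auto
    ultimately show "A1_weight n a 1 < A1_weight n b 1"
      by (simp add: A1_weight_def)
  qed simp
  from sorted_key_list_of_set_eqI[OF this] show ?thesis
    by simp
qed

text \<open>The reversal acts once on rows and once on columns, and its sign squares to one. This
  reconciles the increasing enumeration in the exterior power with the decreasing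
  coordinates.\<close>

lemma det_reverse_both:
  "det (mat n n (\<lambda>(i, j). f (n - 1 - i) (n - 1 - j))) = det (mat n n (\<lambda>(i, j). f i j))"
proof -
  define p where "p i = (if i < n then n - 1 - i else i)" for i
  have p: "p permutes {0..<n}"
    by (rule bij_imp_permutes, rule bij_betwI[where g = p]) (auto simp: p_def)
  define A B where "A = mat n n (\<lambda>(i, j). f i j)" and "B = mat n n (\<lambda>(i, j). A $$ (p i, j))"
  \<comment> \<open>Columns are permuted as rows of the transpose.\<close>
  have "mat n n (\<lambda>(i, j). transpose_mat B $$ (p i, j)) =
      transpose_mat (mat n n (\<lambda>(i, j). f (n - 1 - i) (n - 1 - j)))"
    by (intro eq_matI) (auto simp: A_def B_def p_def)
  then have "det (mat n n (\<lambda>(i, j). f (n - 1 - i) (n - 1 - j))) =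
      det (mat n n (\<lambda>(i, j). transpose_mat B $$ (p i, j)))"
    by (simp add: det_transpose[of _ n])
  also have "\<dots> = signof p * det B"
    by (subst det_permute_rows[OF _ p]) (simp_all add: B_def det_transpose[of _ n])
  also have "det B = signof p * det A"
    unfolding B_def by (rule det_permute_rows[OF _ p]) (simp add: A_def)
  also have "signof p * (signof p * det A) = det A"
    by (simp add: sign_def)
  finally show ?thesis
    by (simp add: A_def)
qed

theorem proposition6p1:
  fixes k l :: nat
    and S T :: "(nat \<Rightarrow> nat) \<Rightarrow> (nat \<Rightarrow> nat) \<Rightarrow> complex"
  assumes "k \<ge> 1" and "l \<ge> 2"
    and "kac_peterson_matrix cartan_A1_affine 1 (k + l - 1) S"
    and "kac_peterson_matrix (cartan_C_affine l) l k T"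
  shows "\<exists>\<phi>. bij_betw \<phi> (dominant_weights (cartan_C_affine l) l k)
               {I. I \<subseteq> dominant_weights cartan_A1_affine 1 (k + l - 1) \<and> card I = l} \<and>
           (\<exists>c. c \<noteq> 0 \<and>
             (\<forall>\<Lambda>\<in>dominant_weights (cartan_C_affine l) l k.
              \<forall>\<Lambda>'\<in>dominant_weights (cartan_C_affine l) l k.
                T \<Lambda> \<Lambda>' = c * exterior_power (\<lambda>M. M 1) l S (\<phi> \<Lambda>) (\<phi> \<Lambda>')))"
proof -
  let ?D = "dominant_weights (cartan_C_affine l) l k"
  \<comment> \<open>The kernels have parameter \<open>n + 2\<close> for A1 at level \<open>n\<close>
    and \<open>k + Suc l\<close> for C at level \<open>k\<close>; with \<open>Suc n = k + l\<close>
    these coincide.\<close>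
  define n where "n = k + l - 1"
  have l: "l \<ge> 1" and n: "Suc n = k + l"
    using assms(1,2) by (auto simp: n_def)
  define \<phi> where "\<phi> = (\<lambda>\<Lambda>. A1_weight n ` shifted_coord_set l \<Lambda>)"
  note bij = bij_betw_shifted_coord_set[OF l, of k, folded n]
  have "bij_betw \<phi> ?D {I. I \<subseteq> dominant_weights cartan_A1_affine 1 n \<and> card I = l}"
    using bij_betw_trans[OF bij bij_betw_image_subsets_card[OF bij_betw_A1_weight]]
    by (simp add: \<phi>_def comp_def)
  moreover obtain c where c: "c \<noteq> 0"
    and S: "\<And>\<Lambda> \<Lambda>'. \<Lambda> \<in> dominant_weights cartan_A1_affine 1 n \<Longrightarrow>
      \<Lambda>' \<in> dominant_weights cartan_A1_affine 1 n \<Longrightarrow>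
      S \<Lambda> \<Lambda>' = c * kp_kernel (n + 2) (Suc (\<Lambda> 1)) (Suc (\<Lambda>' 1))"
    using kac_peterson_A1_eq[OF assms(3)[folded n_def]] by blast
  obtain d where d: "d \<noteq> 0"
    and T: "\<And>\<Lambda> \<Lambda>'. \<Lambda> \<in> ?D \<Longrightarrow> \<Lambda>' \<in> ?D \<Longrightarrow>
      T \<Lambda> \<Lambda>' = d * det (mat l l (\<lambda>(i, j).
        kp_kernel (k + Suc l) (shifted_coord l \<Lambda> i) (shifted_coord l \<Lambda>' j)))"
    using kac_peterson_C_eq_det[OF l assms(4)] by blast
  \<comment> \<open>Each of the \<open>l\<close> rows of the minor carries the constant
    \<open>c\<close> of \<open>S\<close>, whence \<open>c ^ l\<close>; \<open>d\<close> is the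
    constant of \<open>T\<close>.\<close>
  have "T \<Lambda> \<Lambda>' = d / c ^ l * exterior_power (\<lambda>M. M 1) l S (\<phi> \<Lambda>) (\<phi> \<Lambda>')"
    if \<Lambda>: "\<Lambda> \<in> ?D" "\<Lambda>' \<in> ?D" for \<Lambda> \<Lambda>'
  proof -
    let ?K = "\<lambda>i j. kp_kernel (k + Suc l) (shifted_coord l \<Lambda> i) (shifted_coord l \<Lambda>' j)"
    have nth: "sorted_key_list_of_set (\<lambda>M. M 1) (\<phi> M) ! \<nu> = A1_weight n (shifted_coord l M (l - 1 - \<nu>))"
      if "M \<in> ?D" "\<nu> < l" for M \<nu>
    proof -
      have "shifted_coord_set l M \<subseteq> {1..Suc n}"
        using bij_betw_apply[OF bij that(1)] by simp
      then show ?thesis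
        using that(2) by (simp add: \<phi>_def sorted_key_list_of_set_A1_weights
            sorted_list_of_shifted_coord_set shifted_coord_list_def del: One_nat_def)
    qed
    have coord: "shifted_coord l M i \<in> {1..Suc n}" if "M \<in> ?D" "i < l" for M i
      using bij_betw_apply[OF bij that(1)] that(2) by (auto simp: shifted_coord_set_def)
    have entry: "S (A1_weight n a) (A1_weight n b) = c * kp_kernel (k + Suc l) a b"
      if "a \<in> {1..Suc n}" "b \<in> {1..Suc n}" for a b
      using that S[OF bij_betw_apply[OF bij_betw_A1_weight] bij_betw_apply[OF bij_betw_A1_weight], of a b] n
      by (simp add: A1_weight_def)
    have "S (sorted_key_list_of_set (\<lambda>M. M 1) (\<phi> \<Lambda>) ! i)
        (sorted_key_list_of_set (\<lambda>M. M 1) (\<phi> \<Lambda>') ! j) = c * ?K (l - 1 - i) (l - 1 - j)"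
      if "i < l" "j < l" for i j
      unfolding nth[OF \<Lambda>(1) that(1)] nth[OF \<Lambda>(2) that(2)]
      using that by (intro entry coord \<Lambda>) auto
    then have "exterior_power (\<lambda>M. M 1) l S (\<phi> \<Lambda>) (\<phi> \<Lambda>') =
        det (c \<cdot>\<^sub>m mat l l (\<lambda>(i, j). ?K (l - 1 - i) (l - 1 - j)))"
      unfolding exterior_power_def by (intro arg_cong[of _ _ det] eq_matI) simp_all
    also have "\<dots> = c ^ l * det (mat l l (\<lambda>(i, j). ?K i j))"
      by (simp only: det_smult dim_col_mat det_reverse_both[of l ?K])
    finally show ?thesis
      using c T[OF \<Lambda>] by simp
  qed
  ultimately show ?thesis
    using c d unfolding n_def[symmetric] by (intro exI[of _ \<phi>] conjI exI[of _ "d / c ^ l"]) auto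
qed

end
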